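(* Let $d = \infty$ and let $\mathcal{H}$ be a unitarily invariant space on $\mathbb{B}_\infty$ with $\mathcal{H} \neq \mathcal{H}_\gamma$ for all $\gamma \in (0,\infty)$. Let $\phi: \mathbb{B}_\infty \to \mathbb{B}_\infty$ and $\delta: \mathbb{B}_\infty \to \mathbb{C}$ be maps such that $W_{\delta,\phi}$ is unitary on $\mathcal{H}$. If either $\phi \in \operatorname{Aut}(\mathbb{B}_\infty)$ or the reproducing kernel $K$ of $\mathcal{H}$ is bounded (i.e. $\sup_{z \in \mathbb{B}_\infty} K(z,z) < \infty$), then $\phi$ is (the restriction to $\mathbb{B}_\infty$ of) a unitary operator on $\ell^2$.
   Context: $\mathbb{B}_\infty$ is the open unit ball of $\ell^2$; inner products are linear in the first variable. A unitarily invariant space on $\mathbb{B}_\infty$ is a reproducing kernel Hilbert space $\mathcal{H}$ of functions on $\mathbb{B}_\infty$ whose reproducing kernel has the form $K(z,w) = \sum_{n=0}^\infty a_n \langle z,w\rangle^n$ ($z,w \in \mathbb{B}_\infty$, the series converging there), where $a_0 = 1$, $a_1 > 0$ and $a_n \ge 0$ for all $n \ge 2$. For $\gamma \in (0,\infty)$, $\mathcal{H}_\gamma$ is the reproducing kernel Hilbert space on $\mathbb{B}_\infty$ with kernel $K(z,w) = (1 - \langle z,w\rangle)^{-\gamma}$ (principal branch). Here $\mathcal{H} \ne \mathcal{H}_\gamma$ means that they differ as reproducing kernel Hilbert spaces, i.e. their reproducing kernels differ. The weighted composition operator $W_{\delta,\phi}$ on $\mathcal{H}$ is $f \mapsto \delta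 \cdot (f \circ \phi)$. Saying that $W_{\delta,\phi}$ is unitary on $\mathcal{H}$ includes the assertion that it is well defined, i.e. maps $\mathcal{H}$ into $\mathcal{H}$. For Hilbert spaces $\mathcal{E},\mathcal{F}$ and $U \subset \mathcal{E}$ open, $f: U \to \mathcal{F}$ is holomorphic if it is locally bounded and for all $z \in U$, $\xi \in \mathcal{E}$, $\eta \in \mathcal{F}$, the function $\lambda \mapsto \langle f(z+\lambda\xi),\eta\rangle$ is holomorphic in a neighborhood of $0 \in \mathbb{C}$. $\operatorname{Aut}(\mathbb{B}_\infty)$ is the group of bijective holomorphic maps $\mathbb{B}_\infty \to \mathbb{B}_\infty$ with holomorphic inverse. *)

theory Defs
  imports "HOL-Complex_Analysis.Complex_Analysis"
begin

text \<open>
  All Hilbert spaces below are complex and consist of scalar functions on a set of points, with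
  pointwise operations. Such a space is given by its carrier \<open>H\<close>, a set of functions on the type of
  points, and an inner product \<open>ip\<close>, which is linear in the first variable and only meaningful on
  \<open>H\<close>. The sequence space \<open>\<ell>\<^sup>2\<close> is the case where the points are the natural numbers.
\<close>

definition ip_norm :: "(('x \<Rightarrow> complex) \<Rightarrow> ('x \<Rightarrow> complex) \<Rightarrow> complex) \<Rightarrow> ('x \<Rightarrow> complex) \<Rightarrow> real"
  where "ip_norm ip f = sqrt (Re (ip f f))"

definition ip_dist ::
  "(('x \<Rightarrow> complex) \<Rightarrow> ('x \<Rightarrow> complex) \<Rightarrow> complex) \<Rightarrow> ('x \<Rightarrow> complex) \<Rightarrow> ('x \<Rightarrow> complex) \<Rightarrow> real"
  where "ip_dist ip f g = ip_norm ip (\<lambda>x. f x - g x)"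

locale complex_hilbert_space =
  fixes H :: "('x \<Rightarrow> complex) set"
    and ip :: "('x \<Rightarrow> complex) \<Rightarrow> ('x \<Rightarrow> complex) \<Rightarrow> complex"
  assumes zero_mem: "(\<lambda>x. 0) \<in> H"
    and add_mem: "f \<in> H \<Longrightarrow> g \<in> H \<Longrightarrow> (\<lambda>x. f x + g x) \<in> H"
    and scale_mem: "f \<in> H \<Longrightarrow> (\<lambda>x. c * f x) \<in> H"
    and ip_add_left: "f \<in> H \<Longrightarrow> g \<in> H \<Longrightarrow> h \<in> H \<Longrightarrow> ip (\<lambda>x. f x + g x) h = ip f h + ip g h"
    and ip_scale_left: "f \<in> H \<Longrightarrow> h \<in> H \<Longrightarrow> ip (\<lambda>x. c * f x) h = c * ip f h"
    and ip_commute: "f \<in> H \<Longrightarrow> g \<in> H \<Longrightarrow> ip f g = cnj (ip g f)"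
    and ip_nonneg: "f \<in> H \<Longrightarrow> 0 \<le> Re (ip f f)"
    and ip_definite: "f \<in> H \<Longrightarrow> ip f f = 0 \<Longrightarrow> f = (\<lambda>x. 0)"
    and complete: "(\<And>n. s n \<in> H) \<Longrightarrow>
          (\<And>e. 0 < e \<Longrightarrow> \<exists>N. \<forall>m\<ge>N. \<forall>n\<ge>N. ip_dist ip (s m) (s n) < e) \<Longrightarrow>
          \<exists>f\<in>H. (\<lambda>n. ip_dist ip (s n) f) \<longlonglongrightarrow> 0"

definition unitary_on ::
  "('x \<Rightarrow> complex) set \<Rightarrow> (('x \<Rightarrow> complex) \<Rightarrow> ('x \<Rightarrow> complex) \<Rightarrow> complex) \<Rightarrow>
    (('x \<Rightarrow> complex) \<Rightarrow> ('x \<Rightarrow> complex)) \<Rightarrow> bool"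
  where "unitary_on H ip T \<longleftrightarrow>
    (\<forall>f\<in>H. \<forall>g\<in>H. T (\<lambda>x. f x + g x) = (\<lambda>x. T f x + T g x)) \<and>
    (\<forall>c. \<forall>f\<in>H. T (\<lambda>x. c * f x) = (\<lambda>x. c * T f x)) \<and>
    T ` H = H \<and>
    (\<forall>f\<in>H. \<forall>g\<in>H. ip (T f) (T g) = ip f g)"

definition open_subset ::
  "('x \<Rightarrow> complex) set \<Rightarrow> (('x \<Rightarrow> complex) \<Rightarrow> ('x \<Rightarrow> complex) \<Rightarrow> complex) \<Rightarrow>
    ('x \<Rightarrow> complex) set \<Rightarrow> bool"
  where "open_subset E ip U \<longleftrightarrow>
    U \<subseteq> E \<and> (\<forall>z\<in>U. \<exists>r>0. \<forall>w\<in>E. ip_dist ip w z < r \<longrightarrow> w \<in> U)"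

definition holomorphic_map ::
  "('x \<Rightarrow> complex) set \<Rightarrow> (('x \<Rightarrow> complex) \<Rightarrow> ('x \<Rightarrow> complex) \<Rightarrow> complex) \<Rightarrow>
    ('y \<Rightarrow> complex) set \<Rightarrow> (('y \<Rightarrow> complex) \<Rightarrow> ('y \<Rightarrow> complex) \<Rightarrow> complex) \<Rightarrow>
    ('x \<Rightarrow> complex) set \<Rightarrow> (('x \<Rightarrow> complex) \<Rightarrow> ('y \<Rightarrow> complex)) \<Rightarrow> bool"
  where "holomorphic_map E ipE F ipF U f \<longleftrightarrow>
    open_subset E ipE U \<and> f \<in> U \<rightarrow> F \<and>
    (\<forall>z\<in>U. \<exists>r>0. \<exists>C. \<forall>w\<in>U. ip_dist ipE w z < r \<longrightarrow> ip_norm ipF (f w) \<le> C) \<and>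
    (\<forall>z\<in>U. \<forall>\<xi>\<in>E. \<forall>\<eta>\<in>F. (\<lambda>\<zeta>. ipF (f (\<lambda>i. z i + \<zeta> * \<xi> i)) \<eta>) analytic_on {0})"


definition ell2 :: "(nat \<Rightarrow> complex) set"
  where "ell2 = {z. summable (\<lambda>i. (cmod (z i))\<^sup>2)}"

definition ell2_ip :: "(nat \<Rightarrow> complex) \<Rightarrow> (nat \<Rightarrow> complex) \<Rightarrow> complex"
  where "ell2_ip z w = (\<Sum>i. z i * cnj (w i))"

definition ball_inf :: "(nat \<Rightarrow> complex) set"  (\<open>\<bool>\<^sub>\<infinity>\<close>)
  where "\<bool>\<^sub>\<infinity> = {z \<in> ell2. ip_norm ell2_ip z < 1}"

text \<open>The values of an automorphism outside the ball are irrelevant.\<close>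

definition Aut_ball :: "((nat \<Rightarrow> complex) \<Rightarrow> (nat \<Rightarrow> complex)) set"
  where "Aut_ball = {\<phi>. bij_betw \<phi> \<bool>\<^sub>\<infinity> \<bool>\<^sub>\<infinity> \<and>
    holomorphic_map ell2 ell2_ip ell2 ell2_ip \<bool>\<^sub>\<infinity> \<phi> \<and>
    holomorphic_map ell2 ell2_ip ell2 ell2_ip \<bool>\<^sub>\<infinity> (inv_into \<bool>\<^sub>\<infinity> \<phi>)}"


text \<open>
  A function on a set \<open>X\<close> of points is represented by its extension by zero to the whole type, so
  that two functions on \<open>X\<close> are equal iff their representations are.
\<close>

definition on_set :: "'x set \<Rightarrow> ('x \<Rightarrow> complex) \<Rightarrow> ('x \<Rightarrow> complex)"
  where "on_set X f = (\<lambda>x. if x \<in> X then f x else 0)"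

locale rkhs = complex_hilbert_space H ip
  for X :: "'x set"
    and H :: "('x \<Rightarrow> complex) set"
    and ip :: "('x \<Rightarrow> complex) \<Rightarrow> ('x \<Rightarrow> complex) \<Rightarrow> complex" +
  assumes zero_outside: "f \<in> H \<Longrightarrow> x \<notin> X \<Longrightarrow> f x = 0"
    and bounded_eval: "x \<in> X \<Longrightarrow> \<exists>C. \<forall>f\<in>H. cmod (f x) \<le> C * ip_norm ip f"

text \<open>A reproducing kernel is determined by the space on \<open>X \<times> X\<close>; its other values are irrelevant.\<close>

definition reproducing_kernel ::
  "'x set \<Rightarrow> ('x \<Rightarrow> complex) set \<Rightarrow> (('x \<Rightarrow> complex) \<Rightarrow> ('x \<Rightarrow> complex) \<Rightarrow> complex) \<Rightarrow>
    ('x \<Rightarrow> 'x \<Rightarrow> complex) \<Rightarrow> bool"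
  where "reproducing_kernel X H ip K \<longleftrightarrow>
    (\<forall>w\<in>X. on_set X (\<lambda>z. K z w) \<in> H \<and> (\<forall>f\<in>H. f w = ip f (on_set X (\<lambda>z. K z w))))"

definition unitarily_invariant_space ::
  "((nat \<Rightarrow> complex) \<Rightarrow> complex) set \<Rightarrow>
    (((nat \<Rightarrow> complex) \<Rightarrow> complex) \<Rightarrow> ((nat \<Rightarrow> complex) \<Rightarrow> complex) \<Rightarrow> complex) \<Rightarrow>
    ((nat \<Rightarrow> complex) \<Rightarrow> (nat \<Rightarrow> complex) \<Rightarrow> complex) \<Rightarrow> bool"
  where "unitarily_invariant_space H ip K \<longleftrightarrow>
    rkhs \<bool>\<^sub>\<infinity> H ip \<and> reproducing_kernel \<bool>\<^sub>\<infinity> H ip K \<and>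
    (\<exists>a :: nat \<Rightarrow> real. a 0 = 1 \<and> a 1 > 0 \<and> (\<forall>n\<ge>2. a n \<ge> 0) \<and>
      (\<forall>z\<in>\<bool>\<^sub>\<infinity>. \<forall>w\<in>\<bool>\<^sub>\<infinity>. (\<lambda>n. of_real (a n) * ell2_ip z w ^ n) sums K z w))"

text \<open>The kernel of \<open>\<H>\<^sub>\<gamma>\<close>; complex \<open>powr\<close> is the principal branch.\<close>

definition kernel_gamma :: "real \<Rightarrow> (nat \<Rightarrow> complex) \<Rightarrow> (nat \<Rightarrow> complex) \<Rightarrow> complex"
  where "kernel_gamma \<gamma> z w = (1 - ell2_ip z w) powr (of_real (- \<gamma>))"

definition weighted_composition ::
  "'x set \<Rightarrow> ('x \<Rightarrow> complex) \<Rightarrow> ('x \<Rightarrow> 'x) \<Rightarrow> ('x \<Rightarrow> complex) \<Rightarrow> ('x \<Rightarrow> complex)"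
  where "weighted_composition X \<delta> \<phi> f = on_set X (\<lambda>z. \<delta> z * f (\<phi> z))"

end

theory Submission
  imports Defs
begin

text \<open>
  Write \<open>K z w = k \<langle>z, w\<rangle>\<close>. Unitarity of the operator gives
  \<open>K z w = \<delta> z * cnj (\<delta> w) * K (\<phi> z) (\<phi> w)\<close>. If \<open>\<phi>\<close> fixes the origin, this reduces to
  \<open>k \<langle>z, w\<rangle> = k \<langle>\<phi> z, \<phi> w\<rangle>\<close>; as \<open>k\<close> is strictly increasing on \<open>[0, 1)\<close> and injective near 0,
  \<open>\<phi>\<close> preserves inner products, hence is a linear isometry, and it is onto because a vector \<open>y\<close>
  orthogonal to its range would give two different kernel functions, at \<open>y\<close> and at 0, with the
  same image under the operator. It remains to show \<open>b = \<phi> 0 = 0\<close>.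

  If \<open>K\<close> is bounded, the functions \<open>K(\<cdot>, r e\<^sub>n) - 1\<close> are pairwise orthogonal, so Bessel's inequality
  yields \<open>\<delta> (r e\<^sub>n) \<longlonglongrightarrow> \<delta> 0\<close>. With \<open>M = sup K z z\<close>, this gives \<open>k (r\<^sup>2) \<le> \<bar>\<delta> 0\<bar>\<^sup>2 M\<close> for
  all \<open>r < 1\<close>, so \<open>\<bar>\<delta> 0\<bar> \<ge> 1\<close>, whereas \<open>\<bar>\<delta> 0\<bar>\<^sup>2 * K b b = 1\<close>.

  If \<open>\<phi>\<close> is an automorphism with \<open>b \<noteq> 0\<close>, differentiating the kernel identity at the origin expresses
  the inverse of \<open>\<phi>\<close> on the complex line through \<open>b\<close> by \<open>h = k' / k\<close>. The resulting self-map of the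
  disc exchanges 0 and \<open>\<parallel>b\<parallel>\<close>, so by the Schwarz lemma it is a Moebius involution. Hence
  \<open>h u = a\<^sub>1 / (1 - u)\<close>, that is, \<open>k u = (1 - u)\<close> to the power \<open>- a\<^sub>1\<close>.
\<close>

section \<open>Inner product spaces of functions\<close>

text \<open>Completeness is dropped so that \<open>\<ell>\<^sup>2\<close> can be an instance without a proof that it is complete.\<close>

locale function_inner_product =
  fixes H :: "('x \<Rightarrow> complex) set"
    and ip :: "('x \<Rightarrow> complex) \<Rightarrow> ('x \<Rightarrow> complex) \<Rightarrow> complex"
  assumes add_closed: "f \<in> H \<Longrightarrow> g \<in> H \<Longrightarrow> (\<lambda>x. f x + g x) \<in> H"
    and scale_closed: "f \<in> H \<Longrightarrow> (\<lambda>x. c * f x) \<in> H"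
    and add_left: "f \<in> H \<Longrightarrow> g \<in> H \<Longrightarrow> h \<in> H \<Longrightarrow> ip (\<lambda>x. f x + g x) h = ip f h + ip g h"
    and scale_left: "f \<in> H \<Longrightarrow> h \<in> H \<Longrightarrow> ip (\<lambda>x. c * f x) h = c * ip f h"
    and commute: "f \<in> H \<Longrightarrow> g \<in> H \<Longrightarrow> ip f g = cnj (ip g f)"
    and nonneg: "f \<in> H \<Longrightarrow> 0 \<le> Re (ip f f)"
    and definite: "f \<in> H \<Longrightarrow> ip f f = 0 \<Longrightarrow> f = (\<lambda>x. 0)"
begin

lemma add_right: "f \<in> H \<Longrightarrow> g \<in> H \<Longrightarrow> h \<in> H \<Longrightarrow> ip f (\<lambda>x. g x + h x) = ip f g + ip f h"
  using commute[of f "\<lambda>x. g x + h x"] commute[of f g] commute[of f h]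
  by (simp add: add_left add_closed)

lemma scale_right: "f \<in> H \<Longrightarrow> g \<in> H \<Longrightarrow> ip f (\<lambda>x. c * g x) = cnj c * ip f g"
  using commute[of f "\<lambda>x. c * g x"] commute[of f g]
  by (simp add: scale_left scale_closed)

lemma diff_closed: "f \<in> H \<Longrightarrow> g \<in> H \<Longrightarrow> (\<lambda>x. f x - g x) \<in> H"
  using add_closed[of f "\<lambda>x. (-1) * g x"] scale_closed[of g "-1"] by simp

lemma diff_left: "f \<in> H \<Longrightarrow> g \<in> H \<Longrightarrow> h \<in> H \<Longrightarrow> ip (\<lambda>x. f x - g x) h = ip f h - ip g h"
  using add_left[of f "\<lambda>x. (-1) * g x" h] scale_left[of g h "-1"] scale_closed[of g "-1"] by simp

lemma diff_right: "f \<in> H \<Longrightarrow> g \<in> H \<Longrightarrow> h \<in> H \<Longrightarrow> ip f (\<lambda>x. g x - h x) = ip f g - ip f h"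
  using add_right[of f g "\<lambda>x. (-1) * h x"] scale_right[of f h "-1"] scale_closed[of h "-1"] by simp

lemmas closed = add_closed scale_closed diff_closed
lemmas left = add_left scale_left diff_left
lemmas right = add_right scale_right diff_right

lemma self_real: "f \<in> H \<Longrightarrow> ip f f = of_real (Re (ip f f))"
  using commute[of f f] by (simp add: complex_eq_iff)

lemma eqI:
  assumes "f \<in> H" "g \<in> H" "\<And>h. h \<in> H \<Longrightarrow> ip f h = ip g h"
  shows "f = g"
proof -
  have "ip (\<lambda>x. f x - g x) (\<lambda>x. f x - g x) = 0"
    using assms diff_closed[of f g] by (simp add: diff_left)
  then have "(\<lambda>x. f x - g x) = (\<lambda>x. 0)"
    using definite assms diff_closed by blast
  then show ?thesis
    by (metis eq_iff_diff_eq_0 ext)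
qed

text \<open>The squared norm of the difference expands to \<open>c - c - c + c\<close>. Linearity
  and homogeneity are later read off from preserved inner products through this criterion.\<close>

lemma eq_by_ip:
  assumes "f \<in> H" "g \<in> H" "ip f f = c" "ip f g = c" "ip g f = c" "ip g g = c"
  shows "f = g"
proof -
  have "ip (\<lambda>x. f x - g x) (\<lambda>x. f x - g x) = 0"
    using assms by (simp add: left right closed)
  then have "(\<lambda>x. f x - g x) = (\<lambda>x. 0)"
    using definite assms diff_closed by blast
  then show ?thesis
    by (metis eq_iff_diff_eq_0 ext)
qed

text \<open>Pythagoras: \<open>d * g\<close> is the orthogonal projection of \<open>f\<close> onto
  the span of \<open>g\<close>. Nonnegativity of the remainder yields Cauchy-Schwarz, and repeated
  removal yields Bessel.\<close>

lemma ip_remove_component: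
  assumes "f \<in> H" "g \<in> H" and c: "ip g g = of_real c" "0 < c" and d: "d = ip f g / of_real c"
  shows "ip (\<lambda>x. f x - d * g x) (\<lambda>x. f x - d * g x)
    = ip f f - of_real ((cmod (ip f g))\<^sup>2 / c)"
proof -
  have "ip g f = cnj (ip f g)"
    using assms commute by blast
  then have "ip (\<lambda>x. f x - d * g x) (\<lambda>x. f x - d * g x)
      = ip f f - cnj d * ip f g - d * cnj (ip f g) + d * cnj d * of_real c"
    using assms(1-3) by (simp add: left right closed algebra_simps)
  moreover have "ip f g * cnj (ip f g) = of_real ((cmod (ip f g))\<^sup>2)"
    by (simp add: complex_norm_square[symmetric])
  then have "cnj d * ip f g = of_real ((cmod (ip f g))\<^sup>2 / c)"
    "d * cnj (ip f g) = of_real ((cmod (ip f g))\<^sup>2 / c)"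
    "d * cnj d * of_real c = of_real ((cmod (ip f g))\<^sup>2 / c)"
    using c by (simp_all add: d mult.commute)
  ultimately show ?thesis
    by simp
qed

lemma Cauchy_Schwarz:
  assumes "f \<in> H" "g \<in> H"
  shows "(cmod (ip f g))\<^sup>2 \<le> Re (ip f f) * Re (ip g g)"
proof (cases "Re (ip g g) = 0")
  case True
  then have "g = (\<lambda>x. 0)"
    using self_real[of g] definite assms by auto
  then have "ip f g = 0"
    using scale_right[OF assms, of 0] by simp
  then show ?thesis
    using True by simp
next
  case False
  define c where "c = Re (ip g g)"
  have c: "0 < c" "ip g g = of_real c"
    using False nonneg[of g] assms self_real[of g] by (auto simp: c_def)
  have "0 \<le> Re (ip f f - of_real ((cmod (ip f g))\<^sup>2 / c))"
    unfolding ip_remove_component[OF assms c(2,1) refl, symmetric]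
    using assms by (intro nonneg closed)
  then show ?thesis
    using c by (simp add: field_simps)
qed

text \<open>The common squared norm \<open>c\<close> is a parameter because the differences of
  kernel functions met later are not normalized.\<close>

lemma Bessel:
  fixes e :: "nat \<Rightarrow> 'x \<Rightarrow> complex"
  assumes f: "f \<in> H" and e: "\<And>i. e i \<in> H" and c: "0 < c"
    and orth: "\<And>i j. ip (e i) (e j) = (if i = j then of_real c else 0)"
  shows "summable (\<lambda>i. (cmod (ip f (e i)))\<^sup>2)"
proof -
  \<comment> \<open>\<open>g\<close> is \<open>f\<close> with its components along the first
    \<open>n\<close> vectors removed. Its inner products with the later \<open>e j\<close> are kept,
    so the next removal subtracts a coefficient of the original \<open>f\<close>.\<close>
  have *: "\<exists>g\<in>H. (\<forall>j\<ge>n. ip g (e j) = ip f (e j)) \<and>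
      Re (ip g g) = Re (ip f f) - (\<Sum>i<n. (cmod (ip f (e i)))\<^sup>2 / c)" for n
  proof (induction n)
    case 0
    then show ?case using f by auto
  next
    case (Suc n)
    then obtain g where g: "g \<in> H" "\<And>j. j \<ge> n \<Longrightarrow> ip g (e j) = ip f (e j)"
      "Re (ip g g) = Re (ip f f) - (\<Sum>i<n. (cmod (ip f (e i)))\<^sup>2 / c)"
      by auto
    define d where "d = ip g (e n) / of_real c"
    have "ip (e n) (e n) = of_real c"
      using orth by simp
    note rc = ip_remove_component[OF g(1) e this c d_def]
    show ?case
    proof (intro bexI conjI allI impI)
      show "(\<lambda>x. g x - d * e n x) \<in> H"
        using g e by (intro closed)
      show "ip (\<lambda>x. g x - d * e n x) (e j) = ip f (e j)" if "j \<ge> Suc n" for j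
      proof -
        have "ip (e n) (e j) = 0"
          using orth that by simp
        then show ?thesis
          using g e that by (simp add: left closed)
      qed
    qed (simp add: rc g)
  qed
  have bound: "(\<Sum>i<n. (cmod (ip f (e i)))\<^sup>2) \<le> c * Re (ip f f)" for n
  proof -
    obtain g where g: "g \<in> H" "Re (ip g g) = Re (ip f f) - (\<Sum>i<n. (cmod (ip f (e i)))\<^sup>2 / c)"
      using * by blast
    then have "(\<Sum>i<n. (cmod (ip f (e i)))\<^sup>2) / c \<le> Re (ip f f)"
      using nonneg[of g] by (simp add: sum_divide_distrib)
    then show ?thesis
      using c by (simp add: field_simps)
  qed
  show ?thesis
    by (rule summableI_nonneg_bounded[OF _ bound]) simp
qed

text \<open>Preservation of inner products makes all four products formed from the two sides equal,
  so \<open>eq_by_ip\<close> applies.\<close>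

lemma ip_preserving_linear:
  assumes U: "\<And>x. x \<in> H \<Longrightarrow> U x \<in> H" and ip: "\<And>x y. x \<in> H \<Longrightarrow> y \<in> H \<Longrightarrow> ip (U x) (U y) = ip x y"
    and xy: "x \<in> H" "y \<in> H"
  shows "U (\<lambda>i. x i + y i) = (\<lambda>i. U x i + U y i)"
    and "U (\<lambda>i. c * x i) = (\<lambda>i. c * U x i)"
proof -
  show "U (\<lambda>i. x i + y i) = (\<lambda>i. U x i + U y i)"
    by (rule eq_by_ip[where c = "ip (\<lambda>i. x i + y i) (\<lambda>i. x i + y i)"])
      (use U ip xy in \<open>simp_all add: left right closed\<close>)
  show "U (\<lambda>i. c * x i) = (\<lambda>i. c * U x i)"
    by (rule eq_by_ip[where c = "ip (\<lambda>i. c * x i) (\<lambda>i. c * x i)"])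
      (use U ip xy in \<open>simp_all add: left right closed\<close>)
qed

end

sublocale complex_hilbert_space \<subseteq> function_inner_product H ip
  by unfold_locales
    (simp_all add: add_mem scale_mem ip_add_left ip_scale_left ip_nonneg ip_definite ip_commute[symmetric])

section \<open>The sequence space\<close>

lemma ell2_ip_summable:
  assumes "z \<in> ell2" "w \<in> ell2"
  shows "summable (\<lambda>i. z i * cnj (w i))"
proof (rule summable_comparison_test'[where N = 0])
  show "summable (\<lambda>i. (cmod (z i))\<^sup>2 + (cmod (w i))\<^sup>2)"
    using assms by (auto simp: ell2_def intro: summable_add)
  show "norm (z i * cnj (w i)) \<le> (cmod (z i))\<^sup>2 + (cmod (w i))\<^sup>2" for i
  proof -
    have "0 \<le> cmod (z i) * cmod (w i)"
      by simp
    then show ?thesis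
      using sum_squares_bound[of "cmod (z i)" "cmod (w i)"]
      unfolding norm_mult complex_mod_cnj by linarith
  qed
qed

lemma ell2_ip_sums: "z \<in> ell2 \<Longrightarrow> w \<in> ell2 \<Longrightarrow> (\<lambda>i. z i * cnj (w i)) sums ell2_ip z w"
  unfolding ell2_ip_def by (intro summable_sums ell2_ip_summable)

lemma ell2_ip_self: "z \<in> ell2 \<Longrightarrow> ell2_ip z z = of_real (\<Sum>i. (cmod (z i))\<^sup>2)"
  by (simp add: ell2_ip_def ell2_def complex_norm_square[symmetric] suminf_of_real flip: of_real_power)

interpretation ell2: function_inner_product ell2 ell2_ip
proof
  fix f g h :: "nat \<Rightarrow> complex" and c :: complex
  show "(\<lambda>x. f x + g x) \<in> ell2" if "f \<in> ell2" "g \<in> ell2"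
  proof -
    have "summable (\<lambda>i. 2 * ((cmod (f i))\<^sup>2 + (cmod (g i))\<^sup>2))"
      using that by (auto simp: ell2_def intro!: summable_mult summable_add)
    moreover have "norm ((cmod (f i + g i))\<^sup>2) \<le> 2 * ((cmod (f i))\<^sup>2 + (cmod (g i))\<^sup>2)" for i
    proof -
      have "(cmod (f i + g i))\<^sup>2 \<le> (cmod (f i) + cmod (g i))\<^sup>2"
        by (intro power_mono norm_triangle_ineq norm_ge_zero)
      also have "\<dots> \<le> 2 * ((cmod (f i))\<^sup>2 + (cmod (g i))\<^sup>2)"
        using sum_squares_bound[of "cmod (f i)" "cmod (g i)"] by (simp add: power2_sum)
      finally show ?thesis by simp
    qed
    ultimately show ?thesis
      unfolding ell2_def mem_Collect_eq by (rule summable_comparison_test'[where N = 0])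
  qed
  show "(\<lambda>x. c * f x) \<in> ell2" if "f \<in> ell2"
    using that by (simp add: ell2_def norm_mult power_mult_distrib summable_mult)
  show "ell2_ip (\<lambda>x. f x + g x) h = ell2_ip f h + ell2_ip g h" if "f \<in> ell2" "g \<in> ell2" "h \<in> ell2"
    using that suminf_add[OF ell2_ip_summable ell2_ip_summable, of f h g h]
    by (simp add: ell2_ip_def distrib_right)
  show "ell2_ip (\<lambda>x. c * f x) h = c * ell2_ip f h" if "f \<in> ell2" "h \<in> ell2"
    using that suminf_mult[OF ell2_ip_summable, of f h c]
    by (simp add: ell2_ip_def mult.assoc)
  show "ell2_ip f g = cnj (ell2_ip g f)" if "f \<in> ell2" "g \<in> ell2"
  proof -
    have "(\<lambda>i. cnj (g i * cnj (f i))) sums cnj (ell2_ip g f)"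
      using ell2_ip_sums[OF that(2,1)] by (subst sums_cnj)
    then show ?thesis
      using ell2_ip_sums[OF that] by (simp add: mult.commute sums_unique2)
  qed
  show "0 \<le> Re (ell2_ip f f)" if "f \<in> ell2"
    using that by (simp add: ell2_ip_self) (auto intro: suminf_nonneg simp: ell2_def)
  show "f = (\<lambda>x. 0)" if "f \<in> ell2" "ell2_ip f f = 0"
    using that by (simp add: ell2_ip_self) (auto simp: ell2_def suminf_eq_zero_iff)
qed

section \<open>Standard basis and truncations\<close>

definition unit_vec :: "nat \<Rightarrow> nat \<Rightarrow> complex"
  where "unit_vec n = (\<lambda>i. if i = n then 1 else 0)"

lemma finite_support_ell2: "(\<lambda>i. if i < n then x i else 0) \<in> ell2"
  unfolding ell2_def mem_Collect_eq
  by (rule summable_finite[of "{..<n}"]) auto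

lemma unit_vec_ell2 [simp]: "unit_vec n \<in> ell2"
  unfolding ell2_def mem_Collect_eq unit_vec_def
  by (rule summable_finite[of "{n}"]) auto

lemma zero_ell2 [simp]: "(\<lambda>i. 0) \<in> ell2"
  by (simp add: ell2_def)

lemma ell2_ip_zero [simp]: "ell2_ip (\<lambda>i. 0) z = 0" "ell2_ip z (\<lambda>i. 0) = 0"
  by (simp_all add: ell2_ip_def)

lemma ell2_ip_unit_vec: "ell2_ip z (unit_vec n) = z n"
  unfolding ell2_ip_def
  by (subst suminf_finite[of "{n}"]) (auto simp: unit_vec_def)

text \<open>The squared distance from \<open>x\<close> to its truncation is a tail of a convergent
  series.\<close>

lemma ell2_truncation:
  assumes "x \<in> ell2"
  shows "(\<lambda>n. Re (ell2_ip (\<lambda>i. x i - (if i < n then x i else 0)) (\<lambda>i. x i - (if i < n then x i else 0)))) \<longlonglongrightarrow> 0"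
proof -
  have sm: "summable (\<lambda>i. (cmod (x i))\<^sup>2)"
    using assms by (simp add: ell2_def)
  have "Re (ell2_ip (\<lambda>i. x i - (if i < n then x i else 0)) (\<lambda>i. x i - (if i < n then x i else 0)))
    = (\<Sum>i. (cmod (x i))\<^sup>2) - (\<Sum>i<n. (cmod (x i))\<^sup>2)" for n
  proof -
    define y where "y = (\<lambda>i. if i < n then x i else 0)"
    have y: "y \<in> ell2"
      unfolding y_def by (rule finite_support_ell2)
    have yx: "ell2_ip y w = (\<Sum>i<n. x i * cnj (w i))" for w
      unfolding ell2_ip_def y_def by (subst suminf_finite[of "{..<n}"]) auto
    have "ell2_ip x y = cnj (ell2_ip y x)"
      using assms y ell2.commute by blast
    then have "ell2_ip (\<lambda>i. x i - y i) (\<lambda>i. x i - y i)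
        = ell2_ip x x - (\<Sum>i<n. x i * cnj (x i))"
      using assms y by (simp add: ell2.left ell2.right ell2.closed yx mult.commute) (simp add: y_def)
    then show ?thesis
      using assms by (simp add: ell2_ip_self y_def complex_norm_square[symmetric] flip: of_real_power of_real_sum)
  qed
  moreover have "(\<lambda>n. (\<Sum>i. (cmod (x i))\<^sup>2) - (\<Sum>i<n. (cmod (x i))\<^sup>2)) \<longlonglongrightarrow>
      (\<Sum>i. (cmod (x i))\<^sup>2) - (\<Sum>i. (cmod (x i))\<^sup>2)"
    by (intro tendsto_intros summable_LIMSEQ sm)
  ultimately show ?thesis by simp
qed

text \<open>A bounded functional vanishing on the standard basis vanishes: approximate by truncations.\<close>

lemma ell2_orthogonal_range:
  assumes U: "\<And>x. x \<in> ell2 \<Longrightarrow> U x \<in> ell2"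
    and ip: "\<And>x y. x \<in> ell2 \<Longrightarrow> y \<in> ell2 \<Longrightarrow> ell2_ip (U x) (U y) = ell2_ip x y"
    and y: "y \<in> ell2" and orth: "\<And>n. ell2_ip (U (unit_vec n)) y = 0" and x: "x \<in> ell2"
  shows "ell2_ip (U x) y = 0"
proof -
  note lin = ell2.ip_preserving_linear[of U, OF U ip]
  define t where "t n = (\<lambda>i. if i < n then x i else 0)" for n
  have t: "t n \<in> ell2" for n
    unfolding t_def by (rule finite_support_ell2)
  have tS: "t (Suc n) = (\<lambda>i. t n i + x n * unit_vec n i)" for n
    by (auto simp: t_def unit_vec_def fun_eq_iff less_Suc_eq)
  have zero: "ell2_ip (U (t n)) y = 0" for n
  proof (induction n)
    case 0
    have "U (\<lambda>i. 0 * x i) = (\<lambda>i. 0 * U x i)"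
      using x lin by blast
    then show ?case by (simp add: t_def)
  next
    case (Suc n)
    then show ?case
      unfolding tS using t y orth U by (simp add: lin ell2.left ell2.closed)
  qed
  have "(cmod (ell2_ip (U x) y))\<^sup>2 \<le> Re (ell2_ip (\<lambda>i. x i - t n i) (\<lambda>i. x i - t n i)) * Re (ell2_ip y y)"
    for n
  proof -
    have d: "(\<lambda>i. x i - t n i) \<in> ell2"
      using x t by (intro ell2.closed)
    have "U x = U (\<lambda>i. t n i + (x i - t n i))"
      by simp
    also have "\<dots> = (\<lambda>i. U (t n) i + U (\<lambda>i. x i - t n i) i)"
      using t d lin by blast
    finally have "ell2_ip (U x) y = ell2_ip (U (\<lambda>i. x i - t n i)) y"
      using t d y U zero by (simp add: ell2.left)
    then show ?thesis
      using ell2.Cauchy_Schwarz[OF U[OF d] y] ip d by simp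
  qed
  moreover have "(\<lambda>n. Re (ell2_ip (\<lambda>i. x i - t n i) (\<lambda>i. x i - t n i)) * Re (ell2_ip y y)) \<longlonglongrightarrow> 0"
    unfolding t_def by (intro tendsto_mult_left_zero ell2_truncation x)
  ultimately have "(cmod (ell2_ip (U x) y))\<^sup>2 \<le> 0"
    by (intro LIMSEQ_le_const) auto
  then show ?thesis by simp
qed

text \<open>The images of the standard basis are orthonormal, so by Bessel the coefficients of
  \<open>y\<close> against them form a vector \<open>c\<close> of \<open>ell2\<close>. Then
  \<open>U c\<close> is the projection of \<open>y\<close> onto the range, and \<open>z\<close> is
  the remainder.\<close>

lemma ell2_range_complement:
  assumes U: "\<And>x. x \<in> ell2 \<Longrightarrow> U x \<in> ell2"
    and ip: "\<And>x y. x \<in> ell2 \<Longrightarrow> y \<in> ell2 \<Longrightarrow> ell2_ip (U x) (U y) = ell2_ip x y"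
    and y: "y \<in> ell2" "y \<notin> U ` ell2"
  obtains z where "z \<in> ell2" "z \<noteq> (\<lambda>i. 0)" "\<And>x. x \<in> ell2 \<Longrightarrow> ell2_ip (U x) z = 0"
proof -
  define c where "c = (\<lambda>n. ell2_ip y (U (unit_vec n)))"
  have "summable (\<lambda>n. (cmod (ell2_ip y (U (unit_vec n))))\<^sup>2)"
    by (rule ell2.Bessel[where c = 1]) (use U ip y in \<open>auto simp: ell2_ip_unit_vec, simp_all add: unit_vec_def\<close>)
  then have c: "c \<in> ell2"
    by (simp add: ell2_def c_def)
  define z where "z = (\<lambda>i. y i - U c i)"
  have z: "z \<in> ell2"
    unfolding z_def using c U y by (intro ell2.closed)
  moreover have "z \<noteq> (\<lambda>i. 0)"
  proof
    assume "z = (\<lambda>i. 0)"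
    then have "y = U c"
      by (auto simp: z_def fun_eq_iff)
    then show False
      using y c by blast
  qed
  moreover have "ell2_ip z (U (unit_vec n)) = 0" for n
    unfolding z_def using y c U ip by (simp add: ell2.left ell2_ip_unit_vec) (simp add: c_def)
  then have "ell2_ip (U (unit_vec n)) z = 0" for n
    using ell2.commute[of "U (unit_vec n)" z] z U by simp
  then have "ell2_ip (U x) z = 0" if "x \<in> ell2" for x
    using ell2_orthogonal_range[OF U ip z _ that] by blast
  ultimately show thesis
    using that by blast
qed

section \<open>The unit ball and scaling into it\<close>

lemma ball_infD: "z \<in> \<bool>\<^sub>\<infinity> \<Longrightarrow> z \<in> ell2"
  by (simp add: ball_inf_def)

lemma ball_inf_iff: "z \<in> \<bool>\<^sub>\<infinity> \<longleftrightarrow> z \<in> ell2 \<and> Re (ell2_ip z z) < 1"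
  by (auto simp: ball_inf_def ip_norm_def)

lemma zero_ball_inf [simp]: "(\<lambda>i. 0) \<in> \<bool>\<^sub>\<infinity>"
  by (simp add: ball_inf_iff)

lemma ell2_ip_scale_self: "z \<in> ell2 \<Longrightarrow> Re (ell2_ip (\<lambda>i. c * z i) (\<lambda>i. c * z i)) = (cmod c)\<^sup>2 * Re (ell2_ip z z)"
  by (simp add: ell2.left ell2.right ell2.closed mult.assoc[symmetric] complex_norm_square[symmetric]
      flip: of_real_power)

lemma scale_ball_inf:
  assumes "z \<in> \<bool>\<^sub>\<infinity>" "cmod c \<le> 1"
  shows "(\<lambda>i. c * z i) \<in> \<bool>\<^sub>\<infinity>"
proof -
  have "(cmod c)\<^sup>2 * Re (ell2_ip z z) \<le> 1 * Re (ell2_ip z z)"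
    using assms ell2.nonneg[of z] by (intro mult_right_mono) (auto simp: power_le_one ball_inf_iff)
  then show ?thesis
    using assms by (auto simp: ball_inf_iff ell2_ip_scale_self ell2.closed)
qed

lemma cmod_ell2_ip_less_1:
  assumes "z \<in> \<bool>\<^sub>\<infinity>" "w \<in> \<bool>\<^sub>\<infinity>"
  shows "cmod (ell2_ip z w) < 1"
proof -
  have "(cmod (ell2_ip z w))\<^sup>2 \<le> Re (ell2_ip z z) * Re (ell2_ip w w)"
    using assms by (intro ell2.Cauchy_Schwarz) (auto simp: ball_inf_iff)
  also have "\<dots> < 1"
    using assms ell2.nonneg[of z] ell2.nonneg[of w]
      mult_strict_mono'[of "Re (ell2_ip z z)" 1 "Re (ell2_ip w w)" 1] by (auto simp: ball_inf_iff)
  finally show ?thesis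
    by (simp add: power_less_one_iff)
qed

lemma ex_scale_ball_inf:
  assumes "z \<in> ell2"
  obtains c :: real where "0 < c" "(\<lambda>i. of_real c * z i) \<in> \<bool>\<^sub>\<infinity>"
proof
  define N where "N = Re (ell2_ip z z)"
  have N: "0 \<le> N"
    using assms ell2.nonneg by (simp add: N_def)
  then show "0 < 1 / (1 + N)"
    by simp
  \<comment> \<open>The scalar \<open>1 / (1 + N)\<close> works for every squared norm
    \<open>N\<close>, that of the zero vector included.\<close>
  have "N < (1 + N)\<^sup>2"
    using N by (simp add: power2_eq_square algebra_simps) (smt (verit) mult_nonneg_nonneg)
  then have "(1 / (1 + N))\<^sup>2 * N < 1"
    using N by (simp add: field_simps power2_eq_square)
  then show "(\<lambda>i. of_real (1 / (1 + N)) * z i) \<in> \<bool>\<^sub>\<infinity>"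
    using assms N unfolding ball_inf_iff
    by (subst ell2_ip_scale_self) (auto simp: ell2.closed N_def norm_divide simp del: of_real_add of_real_divide of_real_1)
qed

section \<open>Holomorphic functions on the disc\<close>

text \<open>The hypotheses say that \<open>f\<close> attains equality in the Schwarz--Pick inequality.\<close>

lemma disc_map_swap:
  fixes s :: real
  assumes hol: "f holomorphic_on ball 0 1" and f: "\<And>t. cmod t < 1 \<Longrightarrow> cmod (f t) < 1"
    and s: "0 < s" "s < 1" and "f 0 = of_real s" "f (of_real s) = 0" and t: "cmod t < 1"
  shows "f t = (of_real s - t) / (1 - of_real s * t)"
proof -
  \<comment> \<open>Composing \<open>f\<close> with the disc automorphism that takes
    \<open>s\<close> to 0 gives \<open>g 0 = 0\<close> and \<open>g s = - s\<close>. This is the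
    equality case of the Schwarz lemma, so \<open>g\<close> is multiplication by -1, and the inverse
    automorphism recovers \<open>f\<close>.\<close>
  define g where "g = (\<lambda>t. Moebius_function 0 (of_real s) (f t))"
  have s1: "cmod (of_real s) < 1"
    using s by simp
  have "(Moebius_function 0 (of_real s) \<circ> f) holomorphic_on ball 0 1"
    by (rule holomorphic_on_compose_gen[OF hol Moebius_function_holomorphic[OF s1]]) (use f in auto)
  then have hg: "g holomorphic_on ball 0 1"
    by (simp add: g_def o_def)
  have g0: "g 0 = 0" and gs: "g (of_real s) = - of_real s"
    using assms by (simp_all add: g_def Moebius_function_def)
  have gn: "cmod (g t) < 1" if "cmod t < 1" for t
    unfolding g_def using s1 f that by (intro Moebius_function_norm_lt_1)
  have "\<exists>z. cmod z < 1 \<and> z \<noteq> 0 \<and> cmod (g z) = cmod z"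
    using s gs by (intro exI[of _ "of_real s"]) auto
  then obtain \<alpha> where \<alpha>: "\<And>z. cmod z < 1 \<Longrightarrow> g z = \<alpha> * z"
    using Schwarz_Lemma(3)[OF hg g0 gn t] by blast
  have "\<alpha> * of_real s = - of_real s"
    using \<alpha>[OF s1] gs by simp
  then have "\<alpha> = -1"
    using s mult_right_cancel[of "of_real s" \<alpha> "-1 :: complex"] by simp
  then have "g t = - t"
    using \<alpha> t by simp
  have "f t = Moebius_function 0 (- of_real s) (g t)"
    unfolding g_def using s1 f t by (intro Moebius_function_compose[symmetric]) auto
  then show ?thesis
    by (simp add: \<open>g t = - t\<close> Moebius_function_def)
qed

section \<open>The kernel as a power series in the inner product\<close>

locale kernel_series =
  fixes a :: "nat \<Rightarrow> real"
  assumes a_0: "a 0 = 1" and a_1: "0 < a 1" and a_nonneg: "0 \<le> a n"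
    and summable_real: "0 \<le> r \<Longrightarrow> r < 1 \<Longrightarrow> summable (\<lambda>n. a n * r ^ n)"
begin

definition k :: "complex \<Rightarrow> complex"
  where "k t = (\<Sum>n. of_real (a n) * t ^ n)"

lemma k_summable: "cmod t < 1 \<Longrightarrow> summable (\<lambda>n. of_real (a n) * t ^ n)"
  by (rule summable_norm_cancel)
    (use summable_real[of "cmod t"] a_nonneg in \<open>simp add: norm_mult norm_power\<close>)

lemma k_0: "k 0 = 1"
  using powser_zero[of "\<lambda>n. of_real (a n) :: complex"] by (simp add: k_def a_0)

lemma k_has_derivative:
  "cmod t < 1 \<Longrightarrow> (k has_field_derivative (\<Sum>n. diffs (\<lambda>n. of_real (a n)) n * t ^ n)) (at t)"
  unfolding k_def[abs_def] by (rule termdiffs_strong'[of 1]) (auto intro: k_summable)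

lemma k_DERIV: "cmod t < 1 \<Longrightarrow> (k has_field_derivative deriv k t) (at t)"
  using k_has_derivative DERIV_imp_deriv by metis

lemma k_holomorphic: "k holomorphic_on ball 0 1"
  using k_DERIV by (fastforce simp: holomorphic_on_open)

lemma deriv_k_holomorphic: "deriv k holomorphic_on ball 0 1"
  by (intro holomorphic_deriv k_holomorphic open_ball)

lemma deriv_k_0: "deriv k 0 = of_real (a 1)"
  using DERIV_imp_deriv[OF k_has_derivative[of 0]] powser_zero[of "diffs (\<lambda>n. of_real (a n) :: complex)"]
  by (simp add: diffs_def)

lemma k_of_real: "0 \<le> r \<Longrightarrow> r < 1 \<Longrightarrow> k (of_real r) = of_real (\<Sum>n. a n * r ^ n)"
  using suminf_of_real[OF summable_real[of r], where 'a = complex] by (simp add: k_def)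

lemma k_strict_mono:
  assumes "0 \<le> r" "r < s" "s < 1"
  shows "Re (k (of_real r)) < Re (k (of_real s))"
proof -
  have "0 < (\<Sum>n. a n * s ^ n - a n * r ^ n)"
  proof (rule suminf_pos2[where i = 1])
    show "summable (\<lambda>n. a n * s ^ n - a n * r ^ n)"
      using assms by (intro summable_diff summable_real) auto
    show "0 \<le> a n * s ^ n - a n * r ^ n" for n
      using assms a_nonneg[of n] by (simp add: mult_left_mono power_mono)
    show "0 < a 1 * s ^ 1 - a 1 * r ^ 1"
      using assms a_1 by simp
  qed
  also have "\<dots> = (\<Sum>n. a n * s ^ n) - (\<Sum>n. a n * r ^ n)"
    using assms by (intro suminf_diff[symmetric] summable_real) auto
  finally show ?thesis
    using assms by (simp add: k_of_real)
qed

lemma k_ge_1: "0 \<le> r \<Longrightarrow> r < 1 \<Longrightarrow> 1 \<le> Re (k (of_real r))"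
  using k_strict_mono[of 0 r] by (cases "r = 0") (simp_all add: k_0)

lemma k_gt_1: "0 < r \<Longrightarrow> r < 1 \<Longrightarrow> 1 < Re (k (of_real r))"
  using k_strict_mono[of 0 r] by (simp add: k_0)

lemma k_real_inj:
  assumes "0 \<le> r" "r < 1" "0 \<le> s" "s < 1" "k (of_real r) = k (of_real s)"
  shows "r = s"
  using k_strict_mono[of r s] k_strict_mono[of s r] assms by (cases r s rule: linorder_cases) auto

text \<open>The derivative at 0 is \<open>a 1\<close>, which is nonzero. This serves complex
  arguments, where monotonicity says nothing.\<close>

lemma k_locally_injective: obtains \<rho> where "0 < \<rho>" "\<rho> < 1" "inj_on k (ball 0 \<rho>)"
proof -
  have "deriv k 0 \<noteq> 0"
    using a_1 by (simp add: deriv_k_0)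
  then obtain r where r: "0 < r" "inj_on k (ball 0 r)"
    using has_complex_derivative_locally_injective[OF k_holomorphic, of 0] by auto
  show thesis
  proof (rule that[of "min r (1/2)"])
    show "inj_on k (ball 0 (min r (1/2)))"
      by (rule inj_on_subset[OF r(2)]) auto
  qed (use r in auto)
qed

text \<open>By the differential equation, \<open>k u * (1 - u) powr a 1\<close> has derivative zero
  on the small disc, hence equals its value 1 at the origin. The identity theorem carries the
  formula to the unit disc.\<close>

lemma k_eq_powr:
  assumes s: "0 < s" "s \<le> 1"
    and ode: "\<And>u. cmod u < s \<Longrightarrow> deriv k u * (1 - u) = of_real (a 1) * k u"
    and t: "cmod t < 1"
  shows "k t = (1 - t) powr (of_real (- a 1))"
proof (rule analytic_continuation_open[of "ball 0 s" "ball 0 1" k])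
  have ne: "1 - u \<notin> \<real>\<^sub>\<le>\<^sub>0" if "cmod u < 1" for u
    using that complex_Re_le_cmod[of u] by (auto simp: complex_nonpos_Reals_iff)
  have D: "((\<lambda>u. k u * (1 - u) powr of_real (a 1)) has_field_derivative 0) (at u)" if "cmod u < s" for u
  proof -
    have u: "cmod u < 1" "1 - u \<noteq> 0"
      using that s by auto
    then have d: "deriv k u = of_real (a 1) * k u / (1 - u)"
      using ode[OF that] by (simp add: field_simps)
    show ?thesis
      by (rule derivative_eq_intros k_DERIV u ne refl)+
        (use u in \<open>simp add: d powr_diff\<close>)
  qed
  have "\<exists>c. \<forall>u\<in>ball 0 s. k u * (1 - u) powr of_real (a 1) = c"
    by (rule has_field_derivative_zero_constant) (use D in \<open>auto intro: DERIV_subset\<close>)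
  then obtain c where c: "\<And>u. cmod u < s \<Longrightarrow> k u * (1 - u) powr of_real (a 1) = c"
    by auto
  have "c = 1"
    using c[of 0] s by (simp add: k_0)
  show "k u = (1 - u) powr (of_real (- a 1))" if "u \<in> ball 0 s" for u
    using c[of u] that \<open>c = 1\<close> inverse_unique[of "(1 - u) powr of_real (a 1)" "k u"]
    by (simp add: powr_minus mult.commute)
  show "(\<lambda>t. (1 - t) powr (of_real (- a 1))) holomorphic_on ball 0 1"
    by (intro holomorphic_intros) (use ne in auto)
qed (use s t k_holomorphic in auto)

end

section \<open>Unitary weighted composition operators\<close>

locale unitary_weighted_composition =
  kernel_series a + rkhs "\<bool>\<^sub>\<infinity>" H ip
  for a :: "nat \<Rightarrow> real"
    and H :: "((nat \<Rightarrow> complex) \<Rightarrow> complex) set"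
    and ip :: "((nat \<Rightarrow> complex) \<Rightarrow> complex) \<Rightarrow> ((nat \<Rightarrow> complex) \<Rightarrow> complex) \<Rightarrow> complex" +
  fixes K :: "(nat \<Rightarrow> complex) \<Rightarrow> (nat \<Rightarrow> complex) \<Rightarrow> complex"
    and \<phi> :: "(nat \<Rightarrow> complex) \<Rightarrow> (nat \<Rightarrow> complex)"
    and \<delta> :: "(nat \<Rightarrow> complex) \<Rightarrow> complex"
  assumes reproducing: "reproducing_kernel \<bool>\<^sub>\<infinity> H ip K"
    and K_eq: "z \<in> \<bool>\<^sub>\<infinity> \<Longrightarrow> w \<in> \<bool>\<^sub>\<infinity> \<Longrightarrow> K z w = k (ell2_ip z w)"
    and \<phi>_ball: "z \<in> \<bool>\<^sub>\<infinity> \<Longrightarrow> \<phi> z \<in> \<bool>\<^sub>\<infinity>"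
    and unitary: "unitary_on H ip (weighted_composition \<bool>\<^sub>\<infinity> \<delta> \<phi>)"
begin

abbreviation W :: "((nat \<Rightarrow> complex) \<Rightarrow> complex) \<Rightarrow> (nat \<Rightarrow> complex) \<Rightarrow> complex"
  where "W \<equiv> weighted_composition \<bool>\<^sub>\<infinity> \<delta> \<phi>"

abbreviation origin :: "nat \<Rightarrow> complex"
  where "origin \<equiv> \<lambda>i. 0"

section \<open>Kernel functions and the transformation rule\<close>

definition kern :: "(nat \<Rightarrow> complex) \<Rightarrow> (nat \<Rightarrow> complex) \<Rightarrow> complex"
  where "kern w = on_set \<bool>\<^sub>\<infinity> (\<lambda>z. K z w)"

lemma kern_mem: "w \<in> \<bool>\<^sub>\<infinity> \<Longrightarrow> kern w \<in> H"
  using reproducing by (simp add: reproducing_kernel_def kern_def)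

lemma ip_kern: "f \<in> H \<Longrightarrow> w \<in> \<bool>\<^sub>\<infinity> \<Longrightarrow> ip f (kern w) = f w"
  using reproducing by (simp add: reproducing_kernel_def kern_def)

lemma kern_apply: "z \<in> \<bool>\<^sub>\<infinity> \<Longrightarrow> w \<in> \<bool>\<^sub>\<infinity> \<Longrightarrow> kern w z = k (ell2_ip z w)"
  by (simp add: kern_def on_set_def K_eq)

lemma W_apply: "z \<in> \<bool>\<^sub>\<infinity> \<Longrightarrow> W f z = \<delta> z * f (\<phi> z)"
  by (simp add: weighted_composition_def on_set_def)

lemma W_mem: "f \<in> H \<Longrightarrow> W f \<in> H"
  using unitary by (auto simp: unitary_on_def)

lemma W_ip: "f \<in> H \<Longrightarrow> g \<in> H \<Longrightarrow> ip (W f) (W g) = ip f g"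
  using unitary by (auto simp: unitary_on_def)

lemma W_surj: assumes "f \<in> H" obtains g where "g \<in> H" "W g = f"
proof -
  have "f \<in> W ` H"
    using unitary assms by (simp add: unitary_on_def)
  then show thesis
    using that by blast
qed

text \<open>The adjoint of \<open>W\<close> sends \<open>kern w\<close> to
  \<open>cnj (\<delta> w)\<close> times \<open>kern (\<phi> w)\<close>. As \<open>W\<close> is
  unitary, this is the preimage \<open>g\<close> of \<open>kern w\<close>, and evaluating
  \<open>W g = kern w\<close> at \<open>z\<close> gives the rule.\<close>

lemma k_transform:
  assumes z: "z \<in> \<bool>\<^sub>\<infinity>" and w: "w \<in> \<bool>\<^sub>\<infinity>"
  shows "k (ell2_ip z w) = \<delta> z * cnj (\<delta> w) * k (ell2_ip (\<phi> z) (\<phi> w))"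
proof -
  obtain g where g: "g \<in> H" "W g = kern w"
    using W_surj kern_mem w by blast
  have "g = (\<lambda>x. cnj (\<delta> w) * kern (\<phi> w) x)"
  proof (rule eqI)
    fix f assume f: "f \<in> H"
    have "ip f g = W f w"
      using W_ip[OF f g(1)] ip_kern[OF W_mem[OF f] w] g by simp
    also have "\<dots> = ip f (\<lambda>x. cnj (\<delta> w) * kern (\<phi> w) x)"
      using f w by (simp add: W_apply ip_kern \<phi>_ball scale_right kern_mem)
    finally show "ip g f = ip (\<lambda>x. cnj (\<delta> w) * kern (\<phi> w) x) f"
      using commute f g w by (metis \<phi>_ball kern_mem scale_closed)
  qed (use g w in \<open>auto intro: closed kern_mem \<phi>_ball\<close>)
  then have "kern w z = \<delta> z * (cnj (\<delta> w) * kern (\<phi> w) (\<phi> z))"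
    using W_apply[OF z, of g] g by simp
  then show ?thesis
    using z w by (simp add: kern_apply \<phi>_ball mult.assoc)
qed

lemma k_transform_0: "z \<in> \<bool>\<^sub>\<infinity> \<Longrightarrow> \<delta> z * cnj (\<delta> origin) * k (ell2_ip (\<phi> z) (\<phi> origin)) = 1"
  and k_transform_0': "z \<in> \<bool>\<^sub>\<infinity> \<Longrightarrow> \<delta> origin * cnj (\<delta> z) * k (ell2_ip (\<phi> origin) (\<phi> z)) = 1"
  using k_transform[of z origin] k_transform[of origin z] by (simp_all add: k_0)

subsection \<open>Maps fixing the origin\<close>

text \<open>Injectivity of \<open>k\<close> on the reals settles the diagonal case. Otherwise
  \<open>w\<close> is shrunk until all inner products lie where \<open>k\<close> is injective;
  \<open>eq_by_ip\<close> then shows that \<open>\<phi>\<close> commutes with this shrinking, and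
  the factor cancels.\<close>

lemma preserves_ip:
  assumes fix0: "\<phi> origin = origin" and z: "z \<in> \<bool>\<^sub>\<infinity>" and w: "w \<in> \<bool>\<^sub>\<infinity>"
  shows "ell2_ip (\<phi> z) (\<phi> w) = ell2_ip z w"
proof -
  have k_inv: "k (ell2_ip (\<phi> z) (\<phi> w)) = k (ell2_ip z w)" if "z \<in> \<bool>\<^sub>\<infinity>" "w \<in> \<bool>\<^sub>\<infinity>" for z w
  proof -
    \<comment> \<open>The weight is a constant of modulus one, so it drops out of
      \<open>k_transform\<close>.\<close>
    have "\<delta> z * cnj (\<delta> origin) = 1" "\<delta> origin * cnj (\<delta> w) = 1" "\<delta> origin * cnj (\<delta> origin) = 1"
      using k_transform_0[OF that(1)] k_transform_0'[OF that(2)] k_transform_0[of origin]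
      by (simp_all add: fix0 k_0)
    then have "\<delta> z * cnj (\<delta> w) = 1"
      by (metis (no_types, lifting) mult.assoc mult.commute mult.left_neutral)
    then show ?thesis
      using k_transform[OF that] by simp
  qed
  have norm_inv: "ell2_ip (\<phi> z) (\<phi> z) = ell2_ip z z" if z: "z \<in> \<bool>\<^sub>\<infinity>" for z
  proof -
    have r: "ell2_ip z z = of_real (Re (ell2_ip z z))" "ell2_ip (\<phi> z) (\<phi> z) = of_real (Re (ell2_ip (\<phi> z) (\<phi> z)))"
      using z \<phi>_ball ball_infD ell2.self_real by blast+
    have "k (of_real (Re (ell2_ip (\<phi> z) (\<phi> z)))) = k (of_real (Re (ell2_ip z z)))"
      using k_inv[OF z z] r by simp
    then have "Re (ell2_ip (\<phi> z) (\<phi> z)) = Re (ell2_ip z z)"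
      using z \<phi>_ball[OF z] by (intro k_real_inj) (auto simp: ball_inf_iff ell2.nonneg)
    then show ?thesis
      using r by simp
  qed
  obtain \<rho> where \<rho>: "0 < \<rho>" "\<rho> < 1" "inj_on k (ball 0 \<rho>)"
    by (rule k_locally_injective)
  define t where "t = \<rho> / 2"
  have t: "0 < t" "t < \<rho>" "t < 1"
    using \<rho> by (auto simp: t_def)
  define tw where "tw = (\<lambda>i. of_real t * w i)"
  have tw: "tw \<in> \<bool>\<^sub>\<infinity>"
    unfolding tw_def using t w by (intro scale_ball_inf) auto
  \<comment> \<open>Only the norm of \<open>y\<close> is prescribed, so the bound covers both
    \<open>tw\<close> and its image under \<open>\<phi>\<close>.\<close>
  have small: "cmod (ell2_ip x y) < \<rho>" if "x \<in> \<bool>\<^sub>\<infinity>" "y \<in> \<bool>\<^sub>\<infinity>" "ell2_ip y y = ell2_ip tw tw" for x y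
  proof -
    have "(cmod (ell2_ip x y))\<^sup>2 \<le> Re (ell2_ip x x) * Re (ell2_ip y y)"
      using that by (intro ell2.Cauchy_Schwarz ball_infD)
    also have "\<dots> \<le> 1 * Re (ell2_ip y y)"
      using that ell2.nonneg[of y] by (intro mult_right_mono) (auto simp: ball_inf_iff)
    also have "\<dots> = t\<^sup>2 * Re (ell2_ip w w)"
      using that w by (simp add: tw_def ell2_ip_scale_self ball_infD)
    also have "\<dots> \<le> t\<^sup>2 * 1"
      using w by (intro mult_left_mono) (auto simp: ball_inf_iff)
    finally have "cmod (ell2_ip x y) \<le> t"
      using t power2_le_imp_le[of "cmod (ell2_ip x y)" t] by simp
    then show ?thesis
      using t by simp
  qed
  have step: "ell2_ip (\<phi> x) (\<phi> tw) = of_real t * ell2_ip x w" if "x \<in> \<bool>\<^sub>\<infinity>" for x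
  proof -
    have "ell2_ip (\<phi> x) (\<phi> tw) = ell2_ip x tw"
    proof (rule inj_onD[OF \<rho>(3) k_inv[OF that tw]])
      show "ell2_ip x tw \<in> ball 0 \<rho>"
        using small[OF that tw refl] by simp
      show "ell2_ip (\<phi> x) (\<phi> tw) \<in> ball 0 \<rho>"
        using small[OF \<phi>_ball[OF that] \<phi>_ball[OF tw] norm_inv[OF tw]] by simp
    qed
    also have "\<dots> = of_real t * ell2_ip x w"
      using ell2.scale_right[OF ball_infD[OF that] ball_infD[OF w], of "of_real t"] by (simp add: tw_def)
    finally show ?thesis .
  qed
  note mem = ball_infD[OF w] ball_infD[OF z] ball_infD[OF tw] ball_infD[OF \<phi>_ball[OF w]]
    ball_infD[OF \<phi>_ball[OF z]] ball_infD[OF \<phi>_ball[OF tw]]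
  have "\<phi> tw = (\<lambda>i. of_real t * \<phi> w i)"
  proof (rule ell2.eq_by_ip[where c = "of_real t * (of_real t * ell2_ip w w)"])
    have "cnj (ell2_ip w w) = ell2_ip w w"
      using mem ell2.commute[of w w] by simp
    then show "ell2_ip (\<phi> tw) (\<lambda>i. of_real t * \<phi> w i) = of_real t * (of_real t * ell2_ip w w)"
      using step[OF w] ell2.commute[of "\<phi> tw" "\<phi> w"] mem by (simp add: ell2.right)
    show "ell2_ip (\<phi> tw) (\<phi> tw) = of_real t * (of_real t * ell2_ip w w)"
      using mem tw by (simp add: norm_inv) (simp add: tw_def ell2.left ell2.right ell2.closed)
  qed (use mem step[OF w] norm_inv[OF w] in \<open>simp_all add: ell2.left ell2.right ell2.closed\<close>)
  then have "of_real t * ell2_ip (\<phi> z) (\<phi> w) = of_real t * ell2_ip z w"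
    using step[OF z] mem by (simp add: ell2.right)
  then show ?thesis
    using t by simp
qed

lemma unitary_if_fixes_origin:
  assumes fix0: "\<phi> origin = origin"
  shows "\<exists>U. unitary_on ell2 ell2_ip U \<and> (\<forall>z\<in>\<bool>\<^sub>\<infinity>. \<phi> z = U z)"
proof -
  have "\<exists>c::real. 0 < c \<and> (\<lambda>i. of_real c * x i) \<in> \<bool>\<^sub>\<infinity>" if "x \<in> ell2" for x
    using ex_scale_ball_inf[OF that] by blast
  then obtain c :: "(nat \<Rightarrow> complex) \<Rightarrow> real" where
    c: "\<And>x. x \<in> ell2 \<Longrightarrow> 0 < c x" "\<And>x. x \<in> ell2 \<Longrightarrow> (\<lambda>i. of_real (c x) * x i) \<in> \<bool>\<^sub>\<infinity>"
    by metis
  define s where "s x = (\<lambda>i. of_real (c x) * x i)" for x :: "nat \<Rightarrow> complex"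
  have s: "s x \<in> \<bool>\<^sub>\<infinity>" "s x \<in> ell2" if "x \<in> ell2" for x
    using c[OF that] ball_infD by (auto simp: s_def)
  \<comment> \<open>Extension by homogeneity. The scalar \<open>c x\<close> depends on the vector,
    so linearity is not visible here; it follows from preserved inner products.\<close>
  define U where "U x = (\<lambda>i. of_real (inverse (c x)) * \<phi> (s x) i)" for x
  have \<phi>s: "\<phi> (s x) \<in> ell2" if "x \<in> ell2" for x
    using s[OF that] \<phi>_ball ball_infD by blast
  have U: "U x \<in> ell2" if "x \<in> ell2" for x
    unfolding U_def using \<phi>s[OF that] by (intro ell2.closed)
  have ip_s: "ell2_ip x (\<phi> (s y)) = of_real (c y) * ell2_ip x (U y)"
    "ell2_ip (\<phi> (s y)) x = of_real (c y) * ell2_ip (U y) x" if "x \<in> ell2" "y \<in> ell2" for x y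
    using that \<phi>s[OF that(2)] c[OF that(2)] by (simp_all add: U_def ell2.left ell2.right)
  have U_ip: "ell2_ip (U x) (U y) = ell2_ip x y" if "x \<in> ell2" "y \<in> ell2" for x y
  proof -
    have "of_real (c x) * (of_real (c y) * ell2_ip (U x) (U y)) = ell2_ip (\<phi> (s x)) (\<phi> (s y))"
      using that U \<phi>s by (simp add: ip_s)
    also have "\<dots> = ell2_ip (s x) (s y)"
      using preserves_ip[OF fix0] s that by simp
    also have "\<dots> = of_real (c x) * (of_real (c y) * ell2_ip x y)"
      using that s by (simp add: s_def ell2.left ell2.right ell2.closed)
    finally show ?thesis
      using c(1)[OF that(1)] c(1)[OF that(2)] by simp
  qed
  have U_\<phi>: "\<phi> z = U z" if z: "z \<in> \<bool>\<^sub>\<infinity>" for z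
  proof -
    have m: "z \<in> ell2" "\<phi> z \<in> ell2" "U z \<in> ell2"
      using z \<phi>_ball ball_infD U by blast+
    have "of_real (c z) * ell2_ip (\<phi> z) (U z) = of_real (c z) * ell2_ip z z"
      "of_real (c z) * ell2_ip (U z) (\<phi> z) = of_real (c z) * ell2_ip z z"
      using m preserves_ip[OF fix0, of z "s z"] preserves_ip[OF fix0, of "s z" z] s[OF m(1)] z
      by (simp_all add: ip_s) (simp_all add: s_def ell2.left ell2.right)
    then have "ell2_ip (\<phi> z) (U z) = ell2_ip z z" "ell2_ip (U z) (\<phi> z) = ell2_ip z z"
      using c(1)[OF m(1)] by simp_all
    then show ?thesis
      using m z U_ip preserves_ip[OF fix0] by (intro ell2.eq_by_ip[where c = "ell2_ip z z"]) auto
  qed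
  have "U ` ell2 = ell2"
  proof (rule ccontr)
    assume "U ` ell2 \<noteq> ell2"
    then obtain y where "y \<in> ell2" "y \<notin> U ` ell2"
      using U by blast
    then obtain y where y: "y \<in> ell2" "y \<noteq> origin" "\<And>x. x \<in> ell2 \<Longrightarrow> ell2_ip (U x) y = 0"
      using ell2_range_complement[OF U U_ip] by metis
    have sy: "s y \<in> \<bool>\<^sub>\<infinity>"
      using s y by blast
    \<comment> \<open>On the range of \<open>\<phi>\<close> both kernel functions take the value
      \<open>k 0\<close>. Since \<open>W\<close> preserves norms, \<open>k\<close> would equal 1 at
      the positive squared norm of \<open>s y\<close>.\<close>
    have "W (kern (s y)) = W (kern origin)"
    proof
      fix z
      show "W (kern (s y)) z = W (kern origin) z"
      proof (cases "z \<in> \<bool>\<^sub>\<infinity>")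
        case True
        then have "ell2_ip (\<phi> z) (s y) = 0"
          using y U by (simp add: s_def U_\<phi> ell2.right ball_infD)
        then show ?thesis
          using True sy by (simp add: W_apply kern_apply \<phi>_ball)
      qed (simp add: weighted_composition_def on_set_def)
    qed
    then have "kern (s y) (s y) = kern origin origin"
      using W_ip[OF kern_mem kern_mem, of "s y" "s y"] W_ip[OF kern_mem kern_mem, of origin origin] sy
      by (simp add: ip_kern kern_mem)
    then have k1: "k (ell2_ip (s y) (s y)) = 1"
      using sy by (simp add: kern_apply k_0)
    have "s y \<noteq> origin"
      using y c(1)[OF y(1)] by (auto simp: s_def fun_eq_iff)
    then have "Re (ell2_ip (s y) (s y)) \<noteq> 0"
      using s y ell2.self_real[of "s y"] ell2.definite[of "s y"] by auto
    then have "1 < Re (k (of_real (Re (ell2_ip (s y) (s y)))))"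
      using sy s y ell2.nonneg[of "s y"] by (intro k_gt_1) (auto simp: ball_inf_iff)
    then show False
      using k1 ell2.self_real[of "s y"] s y by simp
  qed
  then have "unitary_on ell2 ell2_ip U"
    using U_ip ell2.ip_preserving_linear[of U, OF U U_ip] by (simp add: unitary_on_def)
  then show ?thesis
    using U_\<phi> by blast
qed

subsection \<open>Bounded kernels\<close>

text \<open>On the ball \<open>kern origin\<close> is the constant 1, so \<open>W\<close> maps it to
  \<open>\<delta>\<close>. The differences from \<open>\<delta> origin\<close> are its inner
  products with orthogonal functions of equal norm, hence square summable.\<close>

lemma \<delta>_limit:
  assumes r: "0 < r" "r < 1"
  shows "(\<lambda>n. \<delta> (\<lambda>i. of_real r * unit_vec n i)) \<longlonglongrightarrow> \<delta> origin"
proof -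
  define e where "e n = (\<lambda>i. of_real r * unit_vec n i)" for n
  have ip_e: "ell2_ip (e m) (e n) = (if m = n then of_real (r\<^sup>2) else 0)" for m n
    unfolding e_def by (simp add: ell2.left ell2.right ell2.closed ell2_ip_unit_vec)
      (simp add: unit_vec_def power2_eq_square)
  have r2: "0 < r\<^sup>2" "r\<^sup>2 < 1"
    using r by (auto simp: power_less_one_iff)
  have e: "e n \<in> \<bool>\<^sub>\<infinity>" for n
    using r2 ip_e[of n n] unfolding ball_inf_iff by (auto simp: e_def ell2.closed)
  define c where "c = Re (k (of_real (r\<^sup>2))) - 1"
  have c: "0 < c" "k (of_real (r\<^sup>2)) - 1 = of_real c"
    using k_gt_1[OF r2] r2 by (auto simp: c_def k_of_real simp del: of_real_power)
  text \<open>These functions are pairwise orthogonal because \<open>k 0 = 1\<close>.\<close>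
  define g where "g n = (\<lambda>z. kern (e n) z - kern origin z)" for n
  have g: "g n \<in> H" for n
    unfolding g_def using e by (intro closed kern_mem) auto
  have ip_g: "ip f (g n) = f (e n) - f origin" if "f \<in> H" for f n
    unfolding g_def using that e by (simp add: right kern_mem ip_kern)
  have "W (kern origin) \<in> H"
    by (intro W_mem kern_mem zero_ball_inf)
  then have "summable (\<lambda>n. (cmod (ip (W (kern origin)) (g n)))\<^sup>2)"
  proof (rule Bessel[OF _ g c(1)])
    show "ip (g i) (g j) = (if i = j then of_real c else 0)" for i j
      using e g c(2) by (simp add: ip_g) (auto simp: g_def kern_apply ip_e k_0)
  qed
  then have "(\<lambda>n. (cmod (\<delta> (e n) - \<delta> origin))\<^sup>2) \<longlonglongrightarrow> 0"
    using e by (auto simp: ip_g W_mem kern_mem W_apply kern_apply \<phi>_ball k_0 dest: summable_LIMSEQ_zero)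
  then have "(\<lambda>n. \<delta> (e n) - \<delta> origin) \<longlonglongrightarrow> 0"
    by (simp add: tendsto_norm_zero_iff)
  then show ?thesis
    unfolding e_def by (simp add: LIM_zero_iff)
qed

lemma fixes_origin_if_bounded:
  assumes bdd: "bdd_above ((\<lambda>z. Re (K z z)) ` \<bool>\<^sub>\<infinity>)"
  shows "\<phi> origin = origin"
proof -
  define M where "M = (SUP z\<in>\<bool>\<^sub>\<infinity>. Re (K z z))"
  have M: "Re (k (ell2_ip z z)) \<le> M" if "z \<in> \<bool>\<^sub>\<infinity>" for z
    unfolding M_def using cSUP_upper[OF that bdd] that by (simp add: K_eq)
  have M1: "1 \<le> M"
    using M[of origin] by (simp add: k_0)
  \<comment> \<open>Apply \<open>k_transform\<close> on the diagonal at \<open>e n\<close>, bound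
    the kernel at the image by \<open>M\<close>, and let \<open>n\<close> tend to infinity with
    \<open>r\<close> fixed.\<close>
  have bound: "Re (k (of_real (r\<^sup>2))) \<le> (cmod (\<delta> origin))\<^sup>2 * M" if r: "0 < r" "r < 1" for r
  proof -
    define e where "e n = (\<lambda>i. of_real r * unit_vec n i)" for n
    have ip_e: "ell2_ip (e n) (e n) = of_real (r\<^sup>2)" for n
      unfolding e_def by (simp add: ell2.left ell2.right ell2.closed ell2_ip_unit_vec)
        (simp add: unit_vec_def power2_eq_square)
    have e: "e n \<in> \<bool>\<^sub>\<infinity>" for n
      using r ip_e[of n] unfolding ball_inf_iff by (auto simp: e_def ell2.closed power_less_one_iff)
    have "Re (k (of_real (r\<^sup>2))) \<le> (cmod (\<delta> (e n)))\<^sup>2 * M" for n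
    proof -
      have "k (of_real (r\<^sup>2)) = of_real ((cmod (\<delta> (e n)))\<^sup>2) * k (ell2_ip (\<phi> (e n)) (\<phi> (e n)))"
        using k_transform[OF e e, of n n] by (simp add: ip_e complex_norm_square[symmetric])
      then have "Re (k (of_real (r\<^sup>2))) = (cmod (\<delta> (e n)))\<^sup>2 * Re (k (ell2_ip (\<phi> (e n)) (\<phi> (e n))))"
        by (simp del: of_real_power)
      also have "\<dots> \<le> (cmod (\<delta> (e n)))\<^sup>2 * M"
        using M e \<phi>_ball by (intro mult_left_mono) auto
      finally show ?thesis .
    qed
    moreover have "(\<lambda>n. (cmod (\<delta> (e n)))\<^sup>2 * M) \<longlonglongrightarrow> (cmod (\<delta> origin))\<^sup>2 * M"
      unfolding e_def using r by (intro tendsto_intros \<delta>_limit)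
    ultimately show ?thesis
      by (intro LIMSEQ_le_const) auto
  qed
  have "M \<le> (cmod (\<delta> origin))\<^sup>2 * M"
    unfolding M_def
  proof (rule cSUP_least, use zero_ball_inf in blast, fold M_def)
    fix z assume z: "z \<in> \<bool>\<^sub>\<infinity>"
    define q where "q = Re (ell2_ip z z)"
    have q: "0 \<le> q" "q < 1" "ell2_ip z z = of_real q"
      using z ell2.nonneg[of z] ell2.self_real[of z] by (auto simp: q_def ball_inf_iff)
    \<comment> \<open>Any radius with \<open>q < r^2 < 1\<close> would do; the midpoint also keeps
      \<open>r\<close> positive when \<open>q = 0\<close>.\<close>
    define r where "r = sqrt ((1 + q) / 2)"
    have r: "0 < r" "r < 1" "q < r\<^sup>2" "r\<^sup>2 < 1"
      using q by (auto simp: r_def)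
    have "Re (K z z) = Re (k (of_real q))"
      using z q by (simp add: K_eq)
    also have "\<dots> \<le> Re (k (of_real (r\<^sup>2)))"
      using k_strict_mono[of q "r\<^sup>2"] q r by simp
    also have "\<dots> \<le> (cmod (\<delta> origin))\<^sup>2 * M"
      using bound r by blast
    finally show "Re (K z z) \<le> (cmod (\<delta> origin))\<^sup>2 * M" .
  qed
  then have \<delta>1: "1 \<le> (cmod (\<delta> origin))\<^sup>2"
    using M1 by simp
  \<comment> \<open>Here \<open>b\<close> is the squared norm of \<open>\<phi> origin\<close>, not
    the point itself.\<close>
  define b where "b = Re (ell2_ip (\<phi> origin) (\<phi> origin))"
  have \<phi>0: "\<phi> origin \<in> \<bool>\<^sub>\<infinity>" "\<phi> origin \<in> ell2"
    using \<phi>_ball ball_infD by auto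
  have b: "0 \<le> b" "b < 1" "ell2_ip (\<phi> origin) (\<phi> origin) = of_real b"
    using \<phi>0 ell2.nonneg[of "\<phi> origin"] ell2.self_real[of "\<phi> origin"] by (auto simp: b_def ball_inf_iff)
  have "of_real ((cmod (\<delta> origin))\<^sup>2) * k (of_real b) = 1"
    using k_transform_0[of origin] b by (simp add: complex_norm_square[symmetric])
  then have "Re (of_real ((cmod (\<delta> origin))\<^sup>2) * k (of_real b)) = 1"
    by simp
  then have "(cmod (\<delta> origin))\<^sup>2 * Re (k (of_real b)) = 1"
    by (simp del: of_real_power)
  then have "Re (k (of_real b)) \<le> 1"
    using \<delta>1 k_ge_1[OF b(1,2)] by (smt (verit) mult_le_cancel_right1)
  then have "b = 0"
    using k_gt_1[of b] b by force
  then show ?thesis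
    using b by (intro ell2.definite \<phi>0) simp
qed

subsection \<open>Automorphisms moving the origin\<close>

lemma kernel_gamma_if_moves_origin:
  assumes aut: "\<phi> \<in> Aut_ball" and moves: "\<phi> origin \<noteq> origin"
    and zw: "z \<in> \<bool>\<^sub>\<infinity>" "w \<in> \<bool>\<^sub>\<infinity>"
  shows "K z w = kernel_gamma (a 1) z w"
proof -
  have surj: "\<exists>z\<in>\<bool>\<^sub>\<infinity>. \<phi> z = x" if "x \<in> \<bool>\<^sub>\<infinity>" for x
  proof -
    have "x \<in> \<phi> ` \<bool>\<^sub>\<infinity>"
      using aut that by (simp add: Aut_ball_def bij_betw_def)
    then show ?thesis by blast
  qed
  have analytic: "(\<lambda>\<zeta>. ell2_ip (\<phi> (\<lambda>i. \<zeta> * v i)) y) analytic_on {0}" if "v \<in> ell2" "y \<in> ell2" for v y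
  proof -
    have "\<forall>z\<in>\<bool>\<^sub>\<infinity>. \<forall>\<xi>\<in>ell2. \<forall>\<eta>\<in>ell2. (\<lambda>\<zeta>. ell2_ip (\<phi> (\<lambda>i. z i + \<zeta> * \<xi> i)) \<eta>) analytic_on {0}"
      using aut by (simp add: Aut_ball_def holomorphic_map_def)
    from this[rule_format, OF zero_ball_inf that] show ?thesis
      by simp
  qed
  define b where "b = \<phi> origin"
  have b: "b \<in> \<bool>\<^sub>\<infinity>" "b \<in> ell2"
    using \<phi>_ball ball_infD by (auto simp: b_def)
  define s where "s = sqrt (Re (ell2_ip b b))"
  have "Re (ell2_ip b b) \<noteq> 0"
    using moves b ell2.definite[of b] ell2.self_real[of b] by (auto simp: b_def)
  then have s: "0 < s" "s < 1" and s2: "ell2_ip b b = of_real s * of_real s"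
    using b ell2.nonneg[of b] ell2.self_real[of b]
    by (auto simp: s_def ball_inf_iff simp flip: of_real_mult)
  have nz: "k (ell2_ip b (\<phi> z)) \<noteq> 0" if "z \<in> \<bool>\<^sub>\<infinity>" for z
    using k_transform_0'[OF that] by (auto simp: b_def)
  \<comment> \<open>Four instances of \<open>k_transform\<close>, with either argument possibly
    replaced by the origin, combine so that every weight cancels.\<close>
  have ident: "k (ell2_ip w z) * k (ell2_ip (\<phi> w) b) * k (ell2_ip b (\<phi> z))
      = k (ell2_ip (\<phi> w) (\<phi> z)) * k (ell2_ip b b)" if "z \<in> \<bool>\<^sub>\<infinity>" "w \<in> \<bool>\<^sub>\<infinity>" for z w
  proof -
    define d where "d = \<delta> origin * cnj (\<delta> origin)"
    have 0: "d * k (ell2_ip b b) = 1"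
      using k_transform_0[of origin] by (simp add: b_def d_def)
    have 1: "(\<delta> w * cnj (\<delta> z)) * d * (k (ell2_ip (\<phi> w) b) * k (ell2_ip b (\<phi> z))) = 1"
    proof -
      have "(\<delta> w * cnj (\<delta> z)) * d * (k (ell2_ip (\<phi> w) b) * k (ell2_ip b (\<phi> z)))
        = (\<delta> w * cnj (\<delta> origin) * k (ell2_ip (\<phi> w) b)) * (\<delta> origin * cnj (\<delta> z) * k (ell2_ip b (\<phi> z)))"
        by (simp add: d_def)
      then show ?thesis
        using k_transform_0[OF that(2)] k_transform_0'[OF that(1)] by (simp add: b_def)
    qed
    have "d \<noteq> 0"
      using 0 by auto
    have "d * (k (ell2_ip w z) * k (ell2_ip (\<phi> w) b) * k (ell2_ip b (\<phi> z)))
      = k (ell2_ip (\<phi> w) (\<phi> z)) * ((\<delta> w * cnj (\<delta> z)) * d * (k (ell2_ip (\<phi> w) b) * k (ell2_ip b (\<phi> z))))"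
      by (simp add: k_transform[OF that(2,1)])
    also have "\<dots> = d * (k (ell2_ip (\<phi> w) (\<phi> z)) * k (ell2_ip b b))"
      using 0 1 by (simp add: algebra_simps)
    finally show ?thesis
      using \<open>d \<noteq> 0\<close> by simp
  qed
  define h where "h u = deriv k u / k u" for u
  \<comment> \<open>The normalization makes \<open>ell2_ip b (line u) = u\<close>, and the norm of
    \<open>line u\<close> is \<open>cmod u / s\<close>. The conjugate compensates for conjugate
    linearity in the second slot.\<close>
  define line where "line u = (\<lambda>i. cnj (u / (of_real s * of_real s)) * b i)" for u
  have line_ip: "ell2_ip y (line u) = u / (of_real s * of_real s) * ell2_ip y b" if "y \<in> ell2" for y u
    unfolding line_def using that b by (subst ell2.scale_right) auto
  have line_b: "ell2_ip b (line u) = u" for u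
    using s b by (simp add: line_ip s2)
  have line_ball: "line u \<in> \<bool>\<^sub>\<infinity>" if "cmod u < s" for u
  proof -
    have "Re (ell2_ip (line u) (line u)) = (cmod u / s)\<^sup>2"
      unfolding line_def using b s by (subst ell2_ip_scale_self)
        (auto simp: s2 norm_divide norm_mult power2_eq_square simp flip: of_real_mult)
    also have "\<dots> < 1"
      using that s by (simp add: power_less_one_iff)
    finally show ?thesis
      unfolding ball_inf_iff using ell2.scale_closed[OF b(2)] by (auto simp only: line_def)
  qed
  \<comment> \<open>\<open>u\<close> is the inner product of \<open>b\<close> with the point
    \<open>line u\<close> of the range of \<open>\<phi>\<close>, where \<open>nz\<close>
    applies.\<close>
  have k_nz: "k u \<noteq> 0" if "cmod u < s" for u
    using surj[OF line_ball[OF that]] nz line_b[of u] by metis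
  have k_s2: "k (of_real s * of_real s) \<noteq> 0"
    using nz[of origin] s2 by (simp add: b_def)

  text \<open>The identity \<open>ident\<close> is differentiated in \<open>w\<close> at the origin, in the direction \<open>v\<close>.\<close>
  have diff: "of_real (a 1) * ell2_ip v z =
      (u / (of_real s * of_real s) * h u - h (of_real s * of_real s)) * deriv (\<lambda>\<zeta>. ell2_ip (\<phi> (\<lambda>i. \<zeta> * v i)) b) 0"
    if u: "cmod u < s" and z: "z \<in> \<bool>\<^sub>\<infinity>" "\<phi> z = line u" and v: "v \<in> ell2" for u v z
  proof -
    define p where "p = (\<lambda>\<zeta>. ell2_ip (\<phi> (\<lambda>i. \<zeta> * v i)) b)"
    define q where "q = u / (of_real s * of_real s)"
    define S where "S = (of_real s * of_real s :: complex)"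
    have p0: "p 0 = S"
      by (simp add: p_def S_def b_def[symmetric] s2)
    have S1: "cmod S < 1"
      using cmod_ell2_ip_less_1[OF b(1) b(1)] by (simp add: S_def s2)
    have qS: "q * S = u"
      using s by (simp add: q_def S_def)
    have u1: "cmod u < 1"
      using u s by simp
    have p': "(p has_field_derivative deriv p 0) (at 0)"
      using analytic[OF v b(2)] unfolding p_def
      by (intro analytic_derivI) auto
    obtain c :: real where c: "0 < c" "(\<lambda>i. of_real c * v i) \<in> \<bool>\<^sub>\<infinity>"
      using ex_scale_ball_inf[OF v] by blast
    \<comment> \<open>As \<open>\<phi> z = line u\<close>, the inner product with
      \<open>\<phi> z\<close> is \<open>q * p \<zeta>\<close>, and \<open>ident\<close> becomes an
      identity in one variable.\<close>
    have eq: "k (\<zeta> * ell2_ip v z) * k (p \<zeta>) * k u = k (q * p \<zeta>) * k S" if "\<zeta> \<in> ball 0 c" for \<zeta>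
    proof -
      have "(\<lambda>i. \<zeta> / of_real c * (of_real c * v i)) \<in> \<bool>\<^sub>\<infinity>"
        using that c(1) by (intro scale_ball_inf[OF c(2)]) (simp add: norm_divide)
      then have \<zeta>: "(\<lambda>i. \<zeta> * v i) \<in> \<bool>\<^sub>\<infinity>"
        using c by simp
      then show ?thesis
        using ident[OF z(1) \<zeta>] z v b ball_infD[OF z(1)] ball_infD[OF \<phi>_ball[OF \<zeta>]] line_b[of u]
        by (simp add: s2 ell2.left line_ip p_def S_def q_def)
    qed
    have k1: "((\<lambda>\<zeta>. k (\<zeta> * ell2_ip v z)) has_field_derivative of_real (a 1) * ell2_ip v z) (at 0)"
      by (rule DERIV_chain2[where f = k])
        (use k_DERIV[of 0] in \<open>auto simp: deriv_k_0 intro!: derivative_eq_intros\<close>)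
    have k2: "((\<lambda>\<zeta>. k (p \<zeta>)) has_field_derivative deriv k S * deriv p 0) (at 0)"
      by (rule DERIV_chain2[where f = k, OF _ p']) (use k_DERIV[OF S1] p0 in simp)
    have k3: "((\<lambda>\<zeta>. k (q * p \<zeta>)) has_field_derivative deriv k u * (q * deriv p 0)) (at 0)"
      by (rule DERIV_chain2[where f = k, OF _ DERIV_cmult[OF p']]) (use k_DERIV[OF u1] p0 qS in simp)
    have lhs: "((\<lambda>\<zeta>. k (\<zeta> * ell2_ip v z) * k (p \<zeta>) * k u) has_field_derivative
        (of_real (a 1) * ell2_ip v z * k S + deriv k S * deriv p 0) * k u) (at 0)"
      using DERIV_cmult_right[OF DERIV_mult'[OF k1 k2], of "k u"] by (simp add: p0 k_0 algebra_simps)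
    have rhs: "((\<lambda>\<zeta>. k (q * p \<zeta>) * k S) has_field_derivative
        deriv k u * (q * deriv p 0) * k S) (at 0)"
      by (rule DERIV_cmult_right[OF k3])
    have "((\<lambda>\<zeta>. k (\<zeta> * ell2_ip v z) * k (p \<zeta>) * k u) has_field_derivative
        deriv k u * (q * deriv p 0) * k S) (at 0)"
      by (rule has_field_derivative_transform_within_open[OF rhs, of "ball 0 c"]) (use c eq in auto)
    then have "(of_real (a 1) * ell2_ip v z * k S + deriv k S * deriv p 0) * k u
        = deriv k u * (q * deriv p 0) * k S"
      using lhs DERIV_unique by blast
    moreover have "k S \<noteq> 0" "k u \<noteq> 0"
      using k_s2 k_nz[OF u] by (auto simp: S_def)
    ultimately have "of_real (a 1) * ell2_ip v z = (q * h u - h S) * deriv p 0"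
      by (simp add: h_def field_simps)
    then show ?thesis
      by (simp add: q_def S_def p_def)
  qed

  obtain c where c: "c \<in> \<bool>\<^sub>\<infinity>" "\<phi> c = origin" "c \<in> ell2"
    using surj[of origin] ball_infD by auto
  have "c \<noteq> origin"
    using c moves by auto
  have cc: "ell2_ip c c = of_real s * of_real s"
  proof -
    have "k (ell2_ip c c) = k (ell2_ip b b)"
      using ident[OF c(1) c(1)] b by (simp add: c k_0)
    moreover have "ell2_ip c c = of_real (Re (ell2_ip c c))" "ell2_ip b b = of_real (Re (ell2_ip b b))"
      using c b ell2.self_real by blast+
    ultimately have "Re (ell2_ip c c) = Re (ell2_ip b b)"
      using b c ell2.nonneg by (intro k_real_inj) (auto simp: ball_inf_iff)
    then show ?thesis
      using c b ell2.self_real s2 by metis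
  qed
  have line_0: "line 0 = origin"
    by (simp add: line_def)
  define S where "S = (of_real s * of_real s :: complex)"
  \<comment> \<open>The case \<open>u = 0\<close> expresses the unknown derivative of
    \<open>\<phi>\<close> by \<open>ell2_ip v c\<close>, which allows its elimination from
    \<open>diff\<close>.\<close>
  have diff_c: "of_real (a 1) * ell2_ip v c = - h S * deriv (\<lambda>\<zeta>. ell2_ip (\<phi> (\<lambda>i. \<zeta> * v i)) b) 0"
    if "v \<in> ell2" for v
    using diff[of 0 c v] c that s by (simp add: line_0 S_def)
  have hS: "h S \<noteq> 0"
    using diff_c[OF c(3)] a_1 s by (auto simp: cc)
  \<comment> \<open>Since \<open>v\<close> is arbitrary, \<open>z\<close> is a multiple of
    \<open>c\<close>, with the conjugate of the displayed factor as coefficient.\<close>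
  have preimage: "ell2_ip v z = (1 - u / S * h u / h S) * ell2_ip v c"
    if "cmod u < s" "z \<in> \<bool>\<^sub>\<infinity>" "\<phi> z = line u" "v \<in> ell2" for u v z
  proof -
    define P where "P = deriv (\<lambda>\<zeta>. ell2_ip (\<phi> (\<lambda>i. \<zeta> * v i)) b) 0"
    have "of_real (a 1) * ell2_ip v z = (u / S * h u - h S) * P"
      unfolding P_def S_def using that by (rule diff)
    also have "\<dots> = (1 - u / S * h u / h S) * (- h S * P)"
      using hS by (simp add: field_simps)
    also have "- h S * P = of_real (a 1) * ell2_ip v c"
      using diff_c that by (simp add: P_def)
    finally show ?thesis
      using a_1 by simp
  qed

  text \<open>The inverse of \<open>\<phi>\<close> maps the complex line through \<open>b\<close> to that through \<open>c\<close>;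
    up to conjugation and scaling this is the following self-map of the disc.\<close>
  define f where "f t = of_real s - t * h (of_real s * t) / h S" for t
  \<comment> \<open>The squared modulus of \<open>f t\<close> is the squared norm of the preimage of
    \<open>line (s * t)\<close>, which lies in the ball.\<close>
  have f_disc: "cmod (f t) < 1" if t: "cmod t < 1" for t
  proof -
    define u where "u = of_real s * t"
    have u: "cmod u < s"
      using t s by (simp add: u_def norm_mult)
    obtain z where z: "z \<in> \<bool>\<^sub>\<infinity>" "\<phi> z = line u" "z \<in> ell2"
      using surj[OF line_ball[OF u]] ball_infD by blast
    define Q where "Q = 1 - u / S * h u / h S"
    have f: "f t = of_real s * Q"
      using s by (simp add: f_def Q_def S_def u_def algebra_simps)
    have "ell2_ip z z = Q * ell2_ip z c"
      using preimage[OF u z(1,2,3)] by (simp add: Q_def)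
    also have "ell2_ip z c = cnj (Q * ell2_ip c c)"
      using preimage[OF u z(1,2) c(3)] ell2.commute[OF z(3) c(3)] by (simp add: Q_def)
    finally have "ell2_ip z z = f t * cnj (f t)"
      by (simp add: cc f)
    then have "Re (ell2_ip z z) = (cmod (f t))\<^sup>2"
      by (simp add: complex_norm_square[symmetric] flip: of_real_power)
    then have "(cmod (f t))\<^sup>2 < 1"
      using z(1) by (simp add: ball_inf_iff)
    then show ?thesis
      by (simp add: power_less_one_iff)
  qed
  have h_hol: "h holomorphic_on ball 0 s"
    unfolding h_def[abs_def] using s k_nz
    by (intro holomorphic_on_divide holomorphic_on_subset[OF deriv_k_holomorphic]
        holomorphic_on_subset[OF k_holomorphic]) auto
  have "(h \<circ> (\<lambda>t. of_real s * t)) holomorphic_on ball 0 1"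
    by (rule holomorphic_on_compose_gen[OF _ h_hol]) (use s in \<open>auto intro!: holomorphic_intros simp: norm_mult\<close>)
  then have f_hol: "f holomorphic_on ball 0 1"
    unfolding f_def[abs_def] using hS by (intro holomorphic_intros) (auto simp: o_def)
  \<comment> \<open>\<open>f\<close> takes 0 to \<open>s\<close>, and takes \<open>s\<close> to 0
    because \<open>S\<close> is the square of \<open>s\<close>.\<close>
  have f_eq: "f t = (of_real s - t) / (1 - of_real s * t)" if "cmod t < 1" for t
    by (rule disc_map_swap[OF f_hol f_disc s _ _ that]) (use hS in \<open>auto simp: f_def S_def\<close>)
  have h_eq: "h u * (1 - u) = h S * (1 - S)" if u: "cmod u < s" "u \<noteq> 0" for u
  proof -
    define t where "t = u / of_real s"
    have t: "cmod t < 1" "t \<noteq> 0" "of_real s * t = u"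
      using u s by (auto simp: t_def norm_divide)
    have "1 - u \<noteq> 0"
      using u s by auto
    moreover have "t * h u / h S = of_real s - (of_real s - t) / (1 - u)"
      using f_eq[OF t(1)] t(3) by (simp add: f_def algebra_simps)
    ultimately have "t * (h u * (1 - u)) = h S * (of_real s * (1 - u) - (of_real s - t))"
      using hS by (simp add: field_simps)
    also have "\<dots> = t * (h S * (1 - S))"
      unfolding S_def t(3)[symmetric] by (simp add: algebra_simps)
    finally show ?thesis
      using t by simp
  qed
  \<comment> \<open>Cancelling \<open>t\<close> excluded \<open>u = 0\<close>; continuity there
    identifies the constant as \<open>h 0\<close>, which is \<open>a 1\<close>.\<close>
  have "isCont h 0"
    using holomorphic_on_imp_continuous_on[OF h_hol] s by (simp add: continuous_on_eq_continuous_at)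
  then have "((\<lambda>u. h u * (1 - u)) \<longlongrightarrow> h 0 * (1 - 0)) (at 0)"
    by (intro tendsto_intros) (simp add: isCont_def)
  moreover have "((\<lambda>u. h u * (1 - u)) \<longlongrightarrow> h S * (1 - S)) (at 0)"
    by (rule tendsto_eventually) (use h_eq s in \<open>auto simp: eventually_at dist_norm\<close>)
  ultimately have "h S * (1 - S) = h 0"
    using tendsto_unique[of "at (0::complex)"] by force
  then have "h S * (1 - S) = of_real (a 1)"
    by (simp add: h_def deriv_k_0 k_0)
  then have h_all: "h u * (1 - u) = of_real (a 1)" if "cmod u < s" for u
    using h_eq[OF that] by (cases "u = 0") (simp_all add: h_def deriv_k_0 k_0)
  have ode: "deriv k u * (1 - u) = of_real (a 1) * k u" if "cmod u < s" for u
    using h_all[OF that] k_nz[OF that] by (simp add: h_def field_simps)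
  have "k (ell2_ip z w) = (1 - ell2_ip z w) powr of_real (- a 1)"
    using s zw by (intro k_eq_powr[OF _ _ ode] cmod_ell2_ip_less_1) auto
  then show ?thesis
    using zw by (simp add: K_eq kernel_gamma_def)
qed

end

theorem theorem1p3:
  fixes H :: "((nat \<Rightarrow> complex) \<Rightarrow> complex) set"
    and ip :: "((nat \<Rightarrow> complex) \<Rightarrow> complex) \<Rightarrow> ((nat \<Rightarrow> complex) \<Rightarrow> complex) \<Rightarrow> complex"
    and K :: "(nat \<Rightarrow> complex) \<Rightarrow> (nat \<Rightarrow> complex) \<Rightarrow> complex"
    and \<phi> :: "(nat \<Rightarrow> complex) \<Rightarrow> (nat \<Rightarrow> complex)"
    and \<delta> :: "(nat \<Rightarrow> complex) \<Rightarrow> complex"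
  assumes "unitarily_invariant_space H ip K"
    and "\<forall>\<gamma>>0. \<exists>z\<in>\<bool>\<^sub>\<infinity>. \<exists>w\<in>\<bool>\<^sub>\<infinity>. K z w \<noteq> kernel_gamma \<gamma> z w"
    and "\<phi> \<in> \<bool>\<^sub>\<infinity> \<rightarrow> \<bool>\<^sub>\<infinity>"
    and "unitary_on H ip (weighted_composition \<bool>\<^sub>\<infinity> \<delta> \<phi>)"
    and "\<phi> \<in> Aut_ball \<or> bdd_above ((\<lambda>z. Re (K z z)) ` \<bool>\<^sub>\<infinity>)"
  shows "\<exists>U. unitary_on ell2 ell2_ip U \<and> (\<forall>z\<in>\<bool>\<^sub>\<infinity>. \<phi> z = U z)"
proof -
  obtain a :: "nat \<Rightarrow> real" where a: "a 0 = 1" "a 1 > 0" "\<And>n. n \<ge> 2 \<Longrightarrow> a n \<ge> 0"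
    and sums: "\<And>z w. z \<in> \<bool>\<^sub>\<infinity> \<Longrightarrow> w \<in> \<bool>\<^sub>\<infinity> \<Longrightarrow> (\<lambda>n. of_real (a n) * ell2_ip z w ^ n) sums K z w"
    using assms(1) unfolding unitarily_invariant_space_def by blast
  interpret kernel_series a
  proof
    show "0 \<le> a n" for n
      using a by (cases "n = 0 \<or> n = 1") auto
    show "summable (\<lambda>n. a n * r ^ n)" if "0 \<le> r" "r < 1" for r
    proof -
      \<comment> \<open>A vector of squared norm \<open>r\<close> turns convergence of the kernel
        series on the diagonal into convergence at \<open>r\<close>.\<close>
      define z where "z = (\<lambda>i. of_real (sqrt r) * unit_vec 0 i)"
      have zz: "ell2_ip z z = of_real r"
        unfolding z_def using that
        by (simp add: ell2.left ell2.right ell2.closed ell2_ip_unit_vec)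
          (simp add: unit_vec_def flip: of_real_mult)
      then have z: "z \<in> \<bool>\<^sub>\<infinity>"
        unfolding ball_inf_iff using that by (auto simp: z_def ell2.closed)
      have "summable (\<lambda>n. complex_of_real (a n * r ^ n))"
        using sums_summable[OF sums[OF z z]] by (simp add: zz)
      then show ?thesis
        by (simp only: summable_of_real_iff)
    qed
  qed (use a in auto)
  interpret rkhs "\<bool>\<^sub>\<infinity>" H ip
    using assms(1) by (simp add: unitarily_invariant_space_def)
  interpret unitary_weighted_composition a H ip K \<phi> \<delta>
  proof
    show "K z w = k (ell2_ip z w)" if "z \<in> \<bool>\<^sub>\<infinity>" "w \<in> \<bool>\<^sub>\<infinity>" for z w
      using sums_unique[OF sums[OF that]] by (simp add: k_def)
  qed (use assms in \<open>auto simp: unitarily_invariant_space_def\<close>)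
  have "\<phi> (\<lambda>i. 0) = (\<lambda>i. 0)"
    using assms(5)
  proof
    assume aut: "\<phi> \<in> Aut_ball"
    \<comment> \<open>The excluded exponent that matters is \<open>a 1\<close>, which is
      positive.\<close>
    obtain z w where "z \<in> \<bool>\<^sub>\<infinity>" "w \<in> \<bool>\<^sub>\<infinity>" "K z w \<noteq> kernel_gamma (a 1) z w"
      using assms(2) a(2) by meson
    then show ?thesis
      using kernel_gamma_if_moves_origin[OF aut] by metis
  qed (rule fixes_origin_if_bounded)
  then show ?thesis
    by (rule unitary_if_fixes_origin)
qed

end
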